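(* There is a universal constant $c>0$ such that the following holds. Let $\mathscr X\subset\mathbb R^d$ be a closed bounded convex set with positive diameter, and let $\mu>0$ and $\sigma,\Sigma>0$. For all sufficiently large $T$ and for any learning algorithm, there exist a function $f:\mathscr X\times\Xi\to\mathbb R$ and a sequence of distributions $\mathscr D_1,\dots,\mathscr D_T$ on $\Xi$ chosen by the adversary, satisfying assumptions (A1), (A2), (A3), (A4) of the context (for some finite constants $G,L$ and the given $\mu$), with $\sigma_{\max}\ge\sigma$ and $\Sigma_{\max}\ge\Sigma$, and a point $u\in\mathscr X$, such that $$\mathbb E[R_T(u)]\ \ge\ \frac c\mu\left(\sigma_{\max}^2+\Sigma_{\max}^2\right)\log T .$$
   Context: Stochastically extended adversarial (SEA) protocol: $\mathscr X\subset\mathbb R^d$ is closed, bounded and convex, $\Xi$ is a measurable space, $f:\mathscr X\times\Xi\to\mathbb R$, and $\nabla f(x,\xi)$ is the gradient in $x$. In each round $t=1,\dots,T$ the learner chooses $x_t\in\mathscr X$ (based on past observations), the adversary picks a distribution $\mathscr D_t$ on $\Xi$ (possibly depending on past actions and realizations), a sample $\xi_t\sim\mathscr D_t$ is observed by both, and the learner suffers loss $f(x_t,\xi_t)$. $\mathbb E$ is the expectation over the joint law of $(x_1,\xi_1,\dots,x_T,\xi_T)$. For a distribution $\mathscr D$ let $F^{\mathscr D}(x)=\mathbb E_{\xi\sim\mathscr D}[f(x,\xi)]$, $\nabla F^{\mathscr D}(x)=\mathbb E_{\xi\sim\mathscr D}[\nabla f(x,\xi)]$ and $\sigma_{\mathscr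 D}^2=\max_{x\in\mathscr X}\mathbb E_{\xi\sim\mathscr D}\|\nabla f(x,\xi)-\nabla F^{\mathscr D}(x)\|^2$ (Euclidean norm). Write $F^t=F^{\mathscr D_t}$, $\sigma_t^2=\sigma_{\mathscr D_t}^2$, with the convention $F^0:=F^1$. Define $$\sigma_{\max}^2=\max_{t\in[T]}\mathbb E[\sigma_t^2],\qquad \Sigma_{\max}^2=\max_{t\in[T]}\mathbb E\Big[\sup_{x\in\mathscr X}\|\nabla F^t(x)-\nabla F^{t-1}(x)\|^2\Big].$$ Assumptions, for every distribution $\mathscr D$ used by the adversary: (A1) for $\xi\sim\mathscr D$, almost surely $f(\cdot,\xi)$ is convex and its gradients on $\mathscr X$ are bounded in norm by $G$; (A2) $\nabla F^{\mathscr D}$ is $L$-Lipschitz on $\mathscr X$; (A3) $\mathbb E_{\xi\sim\mathscr D}\|\nabla f(x,\xi)-\nabla F^{\mathscr D}(x)\|^2<\infty$ for every $x\in\mathscr X$; (A4) $F^{\mathscr D}$ is $\mu$-strongly convex. Regret: $R_T(u)=\sum_{t=1}^T\big(f(x_t,\xi_t)-f(u,\xi_t)\big)$, $u\in\mathscr X$. *)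

theory Defs
  imports "HOL-Probability.Probability" "HOL-Library.Function_Algebras"
begin

section \<open>Euclidean space of variable dimension\<close>

text \<open>
  The dimension has to be quantified inside a formula, so \<open>\<real>\<^sup>d\<close> is the carrier
  \<^term>\<open>topspace (Euclidean_space d)\<close>: the sequences vanishing from index \<open>d\<close> on.  Its
  topology is the one induced by the product topology of \<^typ>\<open>nat \<Rightarrow> real\<close>, so that the library's
  \<open>borel\<close> and \<open>at x within S\<close> have their usual meaning on it.  The library's metric notions on
  \<^typ>\<open>nat \<Rightarrow> real\<close> (\<open>dist\<close>, \<open>bounded\<close>, \<open>diameter\<close>) belong to a different metric and are not used.
\<close>

instantiation "fun" :: (type, real_vector) real_vector
begin

definition scaleR_fun :: "real \<Rightarrow> ('a \<Rightarrow> 'b) \<Rightarrow> 'a \<Rightarrow> 'b"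
  where "scaleR_fun r x = (\<lambda>i. r *\<^sub>R x i)"

instance
  by standard (simp_all add: scaleR_fun_def fun_eq_iff scaleR_add_left scaleR_add_right)

end

type_synonym real_seq = "nat \<Rightarrow> real"

abbreviation Rn :: "nat \<Rightarrow> real_seq set"
  where "Rn d \<equiv> topspace (Euclidean_space d)"

definition inner_Rn :: "nat \<Rightarrow> real_seq \<Rightarrow> real_seq \<Rightarrow> real"
  where "inner_Rn d x y = (\<Sum>i<d. x i * y i)"

definition norm_Rn :: "nat \<Rightarrow> real_seq \<Rightarrow> real"
  where "norm_Rn d x = L2_set x {..<d}"

definition bounded_Rn :: "nat \<Rightarrow> real_seq set \<Rightarrow> bool"
  where "bounded_Rn d S \<longleftrightarrow> (\<exists>B. \<forall>x\<in>S. norm_Rn d x \<le> B)"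

definition diameter_Rn :: "nat \<Rightarrow> real_seq set \<Rightarrow> real"
  where "diameter_Rn d S = (if S = {} then 0 else SUP (x, y)\<in>S \<times> S. norm_Rn d (x - y))"

definition has_gradient :: "nat \<Rightarrow> (real_seq \<Rightarrow> real) \<Rightarrow> real_seq \<Rightarrow> real_seq \<Rightarrow> bool"
  where "has_gradient d \<phi> x g \<longleftrightarrow> g \<in> Rn d \<and>
    ((\<lambda>y. (\<phi> y - \<phi> x - inner_Rn d g (y - x)) / norm_Rn d (y - x)) \<longlongrightarrow> 0) (at x within Rn d)"

definition gradient :: "nat \<Rightarrow> (real_seq \<Rightarrow> real) \<Rightarrow> real_seq \<Rightarrow> real_seq"
  where "gradient d \<phi> x = (THE g. has_gradient d \<phi> x g)"

lemma has_gradient_unique: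
  assumes x: "x \<in> Rn d" and g: "has_gradient d \<phi> x g" and h: "has_gradient d \<phi> x h"
  shows "g = h"
proof
  fix i
  show "g i = h i"
  proof (cases "i < d")
    case False
    then show ?thesis using g h by (auto simp: has_gradient_def topspace_Euclidean_space)
  next
    case True
    define p where "p s = (\<lambda>j. x j + (if j = i then s else 0))" for s :: real
    have ps: "p s - x = (\<lambda>j. if j = i then s else 0)" for s
      by (auto simp: p_def)
    have "continuous_on UNIV (\<lambda>s. p s j)" for j
      unfolding p_def by (cases "j = i") (auto intro!: continuous_intros)
    then have "continuous_on UNIV p"
      by (intro continuous_on_coordinatewise_then_product)
    then have "isCont p 0"
      by (simp add: continuous_on_eq_continuous_at)
    then have "(p \<longlongrightarrow> x) (at 0)"
      by (simp add: isCont_def p_def)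
    then have lim: "(p \<longlongrightarrow> x) (at_right 0)"
      by (rule tendsto_within_subset) simp
    have "\<forall>\<^sub>F s in at_right 0. p s \<in> Rn d \<and> p s \<noteq> x"
      using x True by (auto simp: eventually_at_filter p_def topspace_Euclidean_space fun_eq_iff)
    with lim have p: "filterlim p (at x within Rn d) (at_right 0)"
      by (simp add: filterlim_at)
    have quot: "((\<lambda>s. (\<phi> (p s) - \<phi> x - k i * s) / \<bar>s\<bar>) \<longlongrightarrow> 0) (at_right 0)"
      if "has_gradient d \<phi> x k" for k
    proof -
      have "((\<lambda>s. (\<phi> (p s) - \<phi> x - inner_Rn d k (p s - x)) / norm_Rn d (p s - x)) \<longlongrightarrow> 0) (at_right 0)"
        using that filterlim_compose[OF _ p] unfolding has_gradient_def by blast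
      moreover have "inner_Rn d k (p s - x) = k i * s" for s
        using True by (simp add: ps inner_Rn_def if_distrib[of "(*) _"] cong: if_cong)
      moreover have "norm_Rn d (p s - x) = \<bar>s\<bar>" for s
        using True by (simp add: ps norm_Rn_def L2_set_def if_distrib[of "\<lambda>r. r\<^sup>2"] cong: if_cong)
      ultimately show ?thesis by simp
    qed
    have "((\<lambda>s. (\<phi> (p s) - \<phi> x - g i * s) / \<bar>s\<bar> - (\<phi> (p s) - \<phi> x - h i * s) / \<bar>s\<bar>) \<longlongrightarrow> 0 - 0)
        (at_right 0)"
      by (intro tendsto_diff quot g h)
    then have "((\<lambda>s. h i - g i) \<longlongrightarrow> 0 - 0) (at_right (0::real))"
      by (rule Lim_transform_eventually) (auto simp: eventually_at_filter field_simps)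
    then show ?thesis by (simp add: tendsto_const_iff)
  qed
qed

definition strongly_convex_on :: "nat \<Rightarrow> real \<Rightarrow> real_seq set \<Rightarrow> (real_seq \<Rightarrow> real) \<Rightarrow> bool"
  where "strongly_convex_on d \<mu> S \<phi> \<longleftrightarrow> convex S \<and>
    (\<forall>x\<in>S. \<forall>y\<in>S. \<forall>s\<in>{0..1}.
      \<phi> (s *\<^sub>R x + (1 - s) *\<^sub>R y)
        \<le> s * \<phi> x + (1 - s) * \<phi> y - \<mu> / 2 * s * (1 - s) * (norm_Rn d (x - y))\<^sup>2)"


section \<open>Losses and distributions\<close>

text \<open>
  A loss is a function on \<open>X \<times> \<Xi>\<close> that extends to a neighbourhood of \<open>X\<close> in \<open>\<real>\<^sup>d\<close>, so that its
  gradient is uniquely determined at every point of \<open>X\<close>, also at boundary points and when \<open>X\<close> has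
  empty interior.  Measurability is what gives meaning to the expectations below.
\<close>

abbreviation actions :: "real_seq set \<Rightarrow> real_seq measure"
  where "actions X \<equiv> restrict_space borel X"

definition loss_function :: "nat \<Rightarrow> real_seq set \<Rightarrow> 'xi measure \<Rightarrow> (real_seq \<Rightarrow> 'xi \<Rightarrow> real) \<Rightarrow> bool"
  where "loss_function d X \<Xi> f \<longleftrightarrow>
    (\<lambda>(x, \<xi>). f x \<xi>) \<in> borel_measurable (actions X \<Otimes>\<^sub>M \<Xi>) \<and>
    (\<forall>x\<in>X. \<forall>\<xi>\<in>space \<Xi>. \<exists>g. has_gradient d (\<lambda>y. f y \<xi>) x g) \<and>
    (\<forall>x\<in>X. \<forall>i<d. (\<lambda>\<xi>. gradient d (\<lambda>y. f y \<xi>) x i) \<in> borel_measurable \<Xi>)"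

definition mean_loss :: "(real_seq \<Rightarrow> 'xi \<Rightarrow> real) \<Rightarrow> 'xi measure \<Rightarrow> real_seq \<Rightarrow> real"
  where "mean_loss f D x = (\<integral>\<xi>. f x \<xi> \<partial>D)"

definition mean_gradient :: "nat \<Rightarrow> (real_seq \<Rightarrow> 'xi \<Rightarrow> real) \<Rightarrow> 'xi measure \<Rightarrow> real_seq \<Rightarrow> real_seq"
  where "mean_gradient d f D x = (\<lambda>i. if i < d then \<integral>\<xi>. gradient d (\<lambda>y. f y \<xi>) x i \<partial>D else 0)"

definition deviation_sq :: "nat \<Rightarrow> (real_seq \<Rightarrow> 'xi \<Rightarrow> real) \<Rightarrow> 'xi measure \<Rightarrow> real_seq \<Rightarrow> 'xi \<Rightarrow> real"
  where "deviation_sq d f D x \<xi> = (norm_Rn d (gradient d (\<lambda>y. f y \<xi>) x - mean_gradient d f D x))\<^sup>2"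

definition variance_sq :: "nat \<Rightarrow> real_seq set \<Rightarrow> (real_seq \<Rightarrow> 'xi \<Rightarrow> real) \<Rightarrow> 'xi measure \<Rightarrow> real"
  where "variance_sq d X f D = (SUP x\<in>X. \<integral>\<xi>. deviation_sq d f D x \<xi> \<partial>D)"

definition shift_sq ::
    "nat \<Rightarrow> real_seq set \<Rightarrow> (real_seq \<Rightarrow> 'xi \<Rightarrow> real) \<Rightarrow> 'xi measure \<Rightarrow> 'xi measure \<Rightarrow> real"
  where "shift_sq d X f D D' = (SUP x\<in>X. (norm_Rn d (mean_gradient d f D x - mean_gradient d f D' x))\<^sup>2)"

definition distribution_assumptions ::
    "nat \<Rightarrow> real_seq set \<Rightarrow> (real_seq \<Rightarrow> 'xi \<Rightarrow> real) \<Rightarrow> real \<Rightarrow> real \<Rightarrow> real \<Rightarrow> 'xi measure \<Rightarrow> bool"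
  where "distribution_assumptions d X f G L \<mu> D \<longleftrightarrow>
    (\<forall>x\<in>X. integrable D (f x)) \<and>
    (AE \<xi> in D. convex_on X (\<lambda>x. f x \<xi>) \<and> (\<forall>x\<in>X. norm_Rn d (gradient d (\<lambda>y. f y \<xi>) x) \<le> G)) \<and>
    (\<forall>x\<in>X. \<forall>y\<in>X. norm_Rn d (mean_gradient d f D x - mean_gradient d f D y) \<le> L * norm_Rn d (x - y)) \<and>
    (\<forall>x\<in>X. integrable D (deviation_sq d f D x)) \<and>
    strongly_convex_on d \<mu> X (mean_loss f D)"


section \<open>The interaction protocol\<close>

text \<open>
  Rounds are numbered \<open>0, \<dots>, T - 1\<close>.  A history of length \<open>t\<close> consists of the pairs \<open>(x\<^sub>s, \<xi>\<^sub>s)\<close> of the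
  rounds \<open>s < t\<close>.  In round \<open>t\<close> learner and adversary simultaneously choose, as functions of that
  history, a distribution of \<open>x\<^sub>t\<close> on \<open>X\<close> (learners may randomize) and the distribution \<open>D\<^sub>t\<close> on
  \<open>\<Xi>\<close>; given the history, \<open>x\<^sub>t\<close> and \<open>\<xi>\<^sub>t\<close> are independent.
\<close>

abbreviation histories :: "real_seq set \<Rightarrow> 'xi measure \<Rightarrow> nat \<Rightarrow> (nat \<Rightarrow> real_seq \<times> 'xi) measure"
  where "histories X \<Xi> t \<equiv> PiM {0..<t} (\<lambda>_. actions X \<Otimes>\<^sub>M \<Xi>)"

type_synonym 'xi learner = "nat \<Rightarrow> (nat \<Rightarrow> real_seq \<times> 'xi) \<Rightarrow> real_seq measure"
type_synonym 'xi adversary = "nat \<Rightarrow> (nat \<Rightarrow> real_seq \<times> 'xi) \<Rightarrow> 'xi measure"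

definition is_learner :: "real_seq set \<Rightarrow> 'xi measure \<Rightarrow> nat \<Rightarrow> 'xi learner \<Rightarrow> bool"
  where "is_learner X \<Xi> T a \<longleftrightarrow> (\<forall>t<T. a t \<in> histories X \<Xi> t \<rightarrow>\<^sub>M prob_algebra (actions X))"

definition is_adversary :: "real_seq set \<Rightarrow> 'xi measure \<Rightarrow> nat \<Rightarrow> 'xi adversary \<Rightarrow> bool"
  where "is_adversary X \<Xi> T D \<longleftrightarrow> (\<forall>t<T. D t \<in> histories X \<Xi> t \<rightarrow>\<^sub>M prob_algebra \<Xi>)"

text \<open>
  A learning algorithm is given the sample space and the loss function, without which observing
  \<open>\<xi>\<^sub>t\<close> would carry no information about the loss \<open>f(\<cdot>, \<xi>\<^sub>t)\<close> of the round; it does not know the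
  adversary's distributions.
\<close>

definition learning_algorithm ::
    "nat \<Rightarrow> real_seq set \<Rightarrow> nat \<Rightarrow> ('xi measure \<Rightarrow> (real_seq \<Rightarrow> 'xi \<Rightarrow> real) \<Rightarrow> 'xi learner) \<Rightarrow> bool"
  where "learning_algorithm d X T A \<longleftrightarrow>
    (\<forall>\<Xi> f. loss_function d X \<Xi> f \<longrightarrow> is_learner X \<Xi> T (A \<Xi> f))"

text \<open>The joint law of the \<open>T\<close> pairs \<open>(x\<^sub>t, \<xi>\<^sub>t)\<close>, a measure on \<^term>\<open>histories X \<Xi> T\<close>.\<close>

primrec joint_law ::
    "real_seq set \<Rightarrow> 'xi measure \<Rightarrow> 'xi learner \<Rightarrow> 'xi adversary \<Rightarrow> nat \<Rightarrow> (nat \<Rightarrow> real_seq \<times> 'xi) measure"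
  where
    "joint_law X \<Xi> a D 0 = return (histories X \<Xi> 0) (\<lambda>_. undefined)"
  | "joint_law X \<Xi> a D (Suc t) = joint_law X \<Xi> a D t \<bind>
      (\<lambda>h. distr (a t h \<Otimes>\<^sub>M D t h) (histories X \<Xi> (Suc t)) (\<lambda>z. h(t := z)))"

definition dist_at :: "'xi adversary \<Rightarrow> nat \<Rightarrow> (nat \<Rightarrow> real_seq \<times> 'xi) \<Rightarrow> 'xi measure"
  where "dist_at D t h = D t (restrict h {0..<t})"

definition regret :: "(real_seq \<Rightarrow> 'xi \<Rightarrow> real) \<Rightarrow> nat \<Rightarrow> real_seq \<Rightarrow> (nat \<Rightarrow> real_seq \<times> 'xi) \<Rightarrow> real"
  where "regret f T u h = (\<Sum>t<T. f (fst (h t)) (snd (h t)) - f u (snd (h t)))"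

definition sigma_sq ::
    "nat \<Rightarrow> real_seq set \<Rightarrow> (real_seq \<Rightarrow> 'xi \<Rightarrow> real) \<Rightarrow> 'xi adversary \<Rightarrow> nat \<Rightarrow> (nat \<Rightarrow> real_seq \<times> 'xi) \<Rightarrow> real"
  where "sigma_sq d X f D t h = variance_sq d X f (dist_at D t h)"

text \<open>
  In the first round \<open>t = 0\<close> the truncating subtraction \<open>t - 1 = 0\<close> implements the convention that
  the mean loss before the first round equals that of the first round.
\<close>

definition Sigma_sq ::
    "nat \<Rightarrow> real_seq set \<Rightarrow> (real_seq \<Rightarrow> 'xi \<Rightarrow> real) \<Rightarrow> 'xi adversary \<Rightarrow> nat \<Rightarrow> (nat \<Rightarrow> real_seq \<times> 'xi) \<Rightarrow> real"
  where "Sigma_sq d X f D t h = shift_sq d X f (dist_at D t h) (dist_at D (t - 1) h)"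

definition sigma_max ::
    "nat \<Rightarrow> real_seq set \<Rightarrow> (real_seq \<Rightarrow> 'xi \<Rightarrow> real) \<Rightarrow> 'xi adversary \<Rightarrow> nat
      \<Rightarrow> (nat \<Rightarrow> real_seq \<times> 'xi) measure \<Rightarrow> real"
  where "sigma_max d X f D T P = sqrt (MAX t\<in>{..<T}. \<integral>h. sigma_sq d X f D t h \<partial>P)"

definition Sigma_max ::
    "nat \<Rightarrow> real_seq set \<Rightarrow> (real_seq \<Rightarrow> 'xi \<Rightarrow> real) \<Rightarrow> 'xi adversary \<Rightarrow> nat
      \<Rightarrow> (nat \<Rightarrow> real_seq \<times> 'xi) measure \<Rightarrow> real"
  where "Sigma_max d X f D T P = sqrt (MAX t\<in>{..<T}. \<integral>h. Sigma_sq d X f D t h \<partial>P)"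

end

theory Submission
  imports Defs
begin

text \<open>
  Fix a direction \<open>v\<close> along a segment of \<open>X\<close> with midpoint \<open>p\<close>, and let the loss be
  \<open>\<mu>/2 * norm (x - p)^2 - s * \<xi> * inner v (x - p)\<close> with a random sign \<open>\<xi>\<close> of mean \<open>\<theta>\<close>.  The mean loss is
  minimal at \<open>p + (s * \<theta> / \<mu>) v\<close>, so a learner with small regret against this point estimates \<open>\<theta>\<close>
  well in every round.  With \<open>\<theta>\<close> uniform on a small interval, a van Trees inequality shows that after
  \<open>t\<close> samples the Bayes risk of any estimate is at least of order \<open>1 / t\<close>; summing over the rounds
  gives \<open>s^2 / \<mu> * ln T\<close> on average over \<open>\<theta>\<close>, hence for some fixed \<open>\<theta>\<close>.  The variance of the
  gradients is \<open>s^2 * (1 - \<theta>^2)\<close>, and one initial round with \<open>\<xi> = 1\<close> makes the shift of the mean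
  gradient equal to \<open>s * (1 - \<theta>)\<close> at the price of a bounded amount of regret.
\<close>

text \<open>An algorithm is told the sample space and the loss, so \<theta> may enter only through
  the adversary; otherwise there would be no single learner to average against. When the bias
  changes, the learner's kernels cancel from the likelihood ratio. All laws are thus densities with
  respect to one reference game, with a fair coin after round 0, and \<theta> and the history can be
  integrated in either order, however adaptive or randomized the learner is. The uniform density
  does not vanish at the ends of its interval, so the usual integration by parts would leave
  boundary terms. An auxiliary weight that vanishes there removes them, and a completed square with
  an explicit multiplier takes the place of the Cauchy-Schwarz inequality. The risk is averaged over
  \<theta> after summation over the rounds, so that one \<theta> serves all of them. The interval
  has to be short, to keep the comparator in X and \<theta> away from 1 and -1. The price is a
  cutoff N below which the samples carry too little information; together with the loss of round 0
  it is absorbed by the threshold on T.\<close>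

section \<open>The interaction protocol\<close>

lemma action_in_domain:
  assumes "h \<in> space (histories X \<Xi> t)" "s < t"
  shows "fst (h s) \<in> X"
proof -
  have "h s \<in> space (actions X \<Otimes>\<^sub>M \<Xi>)"
    using assms by (simp add: space_PiM PiE_iff)
  then show ?thesis
    by (auto simp: space_pair_measure space_restrict_space)
qed

locale interaction =
  fixes X :: "real_seq set" and \<Xi> :: "'xi measure" and a :: "'xi learner" and D :: "'xi adversary"
    and T :: nat
  assumes learner: "is_learner X \<Xi> T a" and adversary: "is_adversary X \<Xi> T D"
begin

abbreviation "H \<equiv> histories X \<Xi>"
abbreviation "law \<equiv> joint_law X \<Xi> a D"

lemma learner_measurable: "t < T \<Longrightarrow> a t \<in> H t \<rightarrow>\<^sub>M prob_algebra (actions X)"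
  using learner by (simp add: is_learner_def)

lemma adversary_measurable: "t < T \<Longrightarrow> D t \<in> H t \<rightarrow>\<^sub>M prob_algebra \<Xi>"
  using adversary by (simp add: is_adversary_def)

lemma measurable_append:
  "(\<lambda>(h, z). h(t := z)) \<in> H t \<Otimes>\<^sub>M (actions X \<Otimes>\<^sub>M \<Xi>) \<rightarrow>\<^sub>M H (Suc t)"
  unfolding atLeast0_lessThan_Suc by (rule measurable_add_dim)

lemma step_kernel_measurable:
  assumes "t < T"
  shows "(\<lambda>h. distr (a t h \<Otimes>\<^sub>M D t h) (H (Suc t)) (\<lambda>z. h(t := z)))
    \<in> H t \<rightarrow>\<^sub>M prob_algebra (H (Suc t))"
  by (rule measurable_distr_prob_space2[OF measurable_pair_prob measurable_append])
    (use assms learner_measurable adversary_measurable in auto)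

lemma joint_law_in_prob_algebra: "t \<le> T \<Longrightarrow> law t \<in> space (prob_algebra (H t))"
proof (induction t)
  case 0
  show ?case
    by (auto simp: space_prob_algebra space_PiM_empty intro!: prob_space_return)
next
  case (Suc t)
  then show ?case
    using prob_space_bind'[OF _ step_kernel_measurable[of t]]
      sets_bind'[OF _ step_kernel_measurable[of t]]
    by (simp add: space_prob_algebra[of "H (Suc t)"])
qed

lemma sets_joint_law: "t \<le> T \<Longrightarrow> sets (law t) = sets (H t)"
  using joint_law_in_prob_algebra[of t] by (simp add: space_prob_algebra)

lemma space_joint_law: "t \<le> T \<Longrightarrow> space (law t) = space (H t)"
  by (rule sets_eq_imp_space_eq) (rule sets_joint_law)

lemma prob_space_joint_law: "t \<le> T \<Longrightarrow> prob_space (law t)"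
  using joint_law_in_prob_algebra[of t] by (simp add: space_prob_algebra)

lemma learner_dist:
  assumes "t < T" "h \<in> space (H t)"
  shows "sets (a t h) = sets (actions X)" "prob_space (a t h)" "space (a t h) = space (actions X)"
  using measurable_space[OF learner_measurable[OF assms(1)] assms(2)] sets_eq_imp_space_eq
  by (auto simp: space_prob_algebra)

lemma adversary_dist:
  assumes "t < T" "h \<in> space (H t)"
  shows "sets (D t h) = sets \<Xi>" "prob_space (D t h)" "space (D t h) = space \<Xi>"
  using measurable_space[OF adversary_measurable[OF assms(1)] assms(2)] sets_eq_imp_space_eq
  by (auto simp: space_prob_algebra)

section \<open>Expectations under the joint law, one round at a time\<close>

lemma integrable_joint_law:
  fixes \<phi> :: "(nat \<Rightarrow> real_seq \<times> 'xi) \<Rightarrow> real"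
  assumes t: "t \<le> T" and m: "\<phi> \<in> borel_measurable (H t)"
    and b: "\<And>h. h \<in> space (H t) \<Longrightarrow> \<bar>\<phi> h\<bar> \<le> B"
  shows "integrable (law t) \<phi>"
proof -
  interpret prob_space "law t" using prob_space_joint_law[OF t] .
  show ?thesis
    using m b by (intro integrable_const_bound[where B = B])
      (auto simp: space_joint_law[OF t] measurable_cong_sets[OF sets_joint_law[OF t] refl])
qed

lemma measurable_append_at:
  assumes "t < T" "h \<in> space (H t)"
  shows "(\<lambda>z. h(t := z)) \<in> a t h \<Otimes>\<^sub>M D t h \<rightarrow>\<^sub>M H (Suc t)"
proof -
  have "(\<lambda>z. h(t := z)) \<in> actions X \<Otimes>\<^sub>M \<Xi> \<rightarrow>\<^sub>M H (Suc t)"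
    using measurable_Pair2[OF measurable_append assms(2)] by simp
  moreover have "sets (a t h \<Otimes>\<^sub>M D t h) = sets (actions X \<Otimes>\<^sub>M \<Xi>)"
    using learner_dist[OF assms] adversary_dist[OF assms] by (intro sets_pair_measure_cong)
  ultimately show ?thesis by (simp cong: measurable_cong_sets)
qed

lemma step_integral_measurable:
  fixes \<phi> :: "(nat \<Rightarrow> real_seq \<times> 'xi) \<Rightarrow> real"
  assumes t: "t < T" and m: "\<phi> \<in> borel_measurable (H (Suc t))"
  shows "(\<lambda>h. \<integral>z. \<phi> (h(t := z)) \<partial>(a t h \<Otimes>\<^sub>M D t h)) \<in> borel_measurable (H t)"
proof -
  have "(\<lambda>h. integral\<^sup>L (distr (a t h \<Otimes>\<^sub>M D t h) (H (Suc t)) (\<lambda>z. h(t := z))) \<phi>)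
      \<in> borel_measurable (H t)"
    by (rule measurable_compose[OF measurable_prob_algebraD[OF step_kernel_measurable[OF t]]
          integral_measurable_subprob_algebra[OF m]])
  then show ?thesis
    by (rule measurable_cong[THEN iffD1, rotated])
      (rule integral_distr[OF measurable_append_at[OF t] m])
qed

lemma step_integral_bound:
  fixes \<phi> :: "(nat \<Rightarrow> real_seq \<times> 'xi) \<Rightarrow> real"
  assumes t: "t < T" and h: "h \<in> space (H t)" and m: "\<phi> \<in> borel_measurable (H (Suc t))"
    and b: "\<And>h. h \<in> space (H (Suc t)) \<Longrightarrow> \<bar>\<phi> h\<bar> \<le> B"
  shows "integrable (a t h \<Otimes>\<^sub>M D t h) (\<lambda>z. \<phi> (h(t := z)))"
    and "\<bar>\<integral>z. \<phi> (h(t := z)) \<partial>(a t h \<Otimes>\<^sub>M D t h)\<bar> \<le> B"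
proof -
  interpret A: prob_space "a t h" using learner_dist h t by auto
  interpret B: prob_space "D t h" using adversary_dist h t by auto
  interpret pair_prob_space "a t h" "D t h" ..
  note ap = measurable_append_at[OF t h]
  have le: "\<bar>\<phi> (h(t := z))\<bar> \<le> B" if "z \<in> space (a t h \<Otimes>\<^sub>M D t h)" for z
    using measurable_space[OF ap that] by (rule b)
  show int: "integrable (a t h \<Otimes>\<^sub>M D t h) (\<lambda>z. \<phi> (h(t := z)))"
    using le measurable_compose[OF ap m] by (intro P.integrable_const_bound[where B = B]) auto
  have "\<bar>\<integral>z. \<phi> (h(t := z)) \<partial>(a t h \<Otimes>\<^sub>M D t h)\<bar>
      \<le> (\<integral>z. \<bar>\<phi> (h(t := z))\<bar> \<partial>(a t h \<Otimes>\<^sub>M D t h))"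
    by (rule integral_abs_bound)
  also have "\<dots> \<le> (\<integral>z. B \<partial>(a t h \<Otimes>\<^sub>M D t h))"
    using int le by (intro integral_mono) auto
  finally show "\<bar>\<integral>z. \<phi> (h(t := z)) \<partial>(a t h \<Otimes>\<^sub>M D t h)\<bar> \<le> B"
    by (simp add: P.prob_space)
qed

text \<open>The tower property for the last round; it reduces expectations under the joint law to
  induction on the number of rounds.\<close>

lemma integral_joint_law_Suc:
  fixes \<phi> :: "(nat \<Rightarrow> real_seq \<times> 'xi) \<Rightarrow> real"
  assumes t: "t < T" and m: "\<phi> \<in> borel_measurable (H (Suc t))"
    and b: "\<And>h. h \<in> space (H (Suc t)) \<Longrightarrow> \<bar>\<phi> h\<bar> \<le> B"
  shows "(\<integral>h. \<phi> h \<partial>law (Suc t)) = (\<integral>h. (\<integral>z. \<phi> (h(t := z)) \<partial>(a t h \<Otimes>\<^sub>M D t h)) \<partial>law t)"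
proof -
  interpret prob_space "law t" using prob_space_joint_law t by simp
  let ?N = "\<lambda>h. distr (a t h \<Otimes>\<^sub>M D t h) (H (Suc t)) (\<lambda>z. h(t := z))"
  have N: "?N \<in> law t \<rightarrow>\<^sub>M prob_algebra (H (Suc t))"
    using step_kernel_measurable[OF t] t by (simp cong: measurable_cong_sets add: sets_joint_law)
  have Np: "emeasure (?N h) (space (H (Suc t))) = 1" if "h \<in> space (law t)" for h
    by (rule in_space_prob_algebra[OF measurable_space[OF N that]])
  have "(\<integral>h. \<phi> h \<partial>law (Suc t)) = (\<integral>h. integral\<^sup>L (?N h) \<phi> \<partial>law t)"
    unfolding joint_law.simps
    by (rule integral_bind[where K = "H (Suc t)" and B' = 1 and B = B])
      (use m b N Np in \<open>auto intro!: measurable_prob_algebraD finite_measure_axioms AE_I2\<close>)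
  also have "\<dots> = (\<integral>h. (\<integral>z. \<phi> (h(t := z)) \<partial>(a t h \<Otimes>\<^sub>M D t h)) \<partial>law t)"
    using t by (intro Bochner_Integration.integral_cong refl integral_distr[OF measurable_append_at m])
      (auto simp: space_joint_law)
  finally show ?thesis .
qed

text \<open>Each later kernel has mass one, so appending rounds leaves the law of an earlier round
  alone. The expected regret thereby splits into rounds, each evaluated under the law that ends with
  it.\<close>

lemma integral_joint_law_marginal:
  fixes \<phi> :: "real_seq \<times> 'xi \<Rightarrow> real"
  assumes m: "\<phi> \<in> borel_measurable (actions X \<Otimes>\<^sub>M \<Xi>)"
    and b: "\<And>z. z \<in> space (actions X \<Otimes>\<^sub>M \<Xi>) \<Longrightarrow> \<bar>\<phi> z\<bar> \<le> B"
    and "t < n" "n \<le> T"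
  shows "(\<integral>h. \<phi> (h t) \<partial>law n) = (\<integral>h. \<phi> (h t) \<partial>law (Suc t))"
proof -
  have "Suc t \<le> n" using \<open>t < n\<close> by simp
  then show ?thesis using \<open>n \<le> T\<close>
  proof (induction n rule: dec_induct)
    case (step n)
    have "(\<integral>h. \<phi> (h t) \<partial>law (Suc n))
        = (\<integral>h. (\<integral>z. \<phi> ((h(n := z)) t) \<partial>(a n h \<Otimes>\<^sub>M D n h)) \<partial>law n)"
    proof (rule integral_joint_law_Suc)
      show "(\<lambda>h. \<phi> (h t)) \<in> borel_measurable (H (Suc n))"
        using step by (intro measurable_compose[OF _ m] measurable_component_singleton) auto
      show "\<bar>\<phi> (h t)\<bar> \<le> B" if "h \<in> space (H (Suc n))" for h
        using that step by (intro b) (auto simp: space_PiM PiE_iff)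
    qed (use step in auto)
    also have "\<dots> = (\<integral>h. \<phi> (h t) \<partial>law n)"
    proof (rule Bochner_Integration.integral_cong)
      fix h assume "h \<in> space (law n)"
      then have h: "h \<in> space (H n)" using step by (simp add: space_joint_law)
      interpret A: prob_space "a n h" using learner_dist h step by auto
      interpret B: prob_space "D n h" using adversary_dist h step by auto
      interpret pair_prob_space "a n h" "D n h" ..
      show "(\<integral>z. \<phi> ((h(n := z)) t) \<partial>(a n h \<Otimes>\<^sub>M D n h)) = \<phi> (h t)"
        using step by (simp add: P.prob_space)
    qed simp
    finally show ?case using step by simp
  qed simp
qed

end

section \<open>Coin-flipping adversaries\<close>

text \<open>The law on signs with mean \<theta>. The weights are coerced to \<open>ennreal\<close>,
  where a negative one would become 0; hence the recurring assumption that \<theta> has absolute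
  value at most 1.\<close>

definition coin :: "real \<Rightarrow> real measure"
  where "coin \<theta> = point_measure {-1, 1} (\<lambda>\<epsilon>. (1 + \<theta> * \<epsilon>) / 2)"

abbreviation signs :: "real measure"
  where "signs \<equiv> count_space {-1, 1}"

lemma sets_coin [measurable_cong]: "sets (coin \<theta>) = sets signs"
  by (simp add: coin_def sets_point_measure)

lemma space_coin [simp]: "space (coin \<theta>) = {-1, 1}"
  by (simp add: coin_def space_point_measure)

lemma integral_coin:
  fixes g :: "real \<Rightarrow> real"
  assumes "\<bar>\<theta>\<bar> \<le> 1"
  shows "integral\<^sup>L (coin \<theta>) g = (1 + \<theta>) / 2 * g 1 + (1 - \<theta>) / 2 * g (- 1)"
  using assms unfolding coin_def by (subst lebesgue_integral_point_measure_finite) auto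

lemma integrable_coin [simp]: "integrable (coin \<theta>) (g :: real \<Rightarrow> real)"
  unfolding coin_def by (rule integrable_point_measure_finite) simp

lemma prob_space_coin:
  assumes "\<bar>\<theta>\<bar> \<le> 1"
  shows "prob_space (coin \<theta>)"
proof
  have "emeasure (coin \<theta>) (space (coin \<theta>))
      = ennreal ((1 - \<theta>) / 2) + ennreal ((1 + \<theta>) / 2)"
    using assms by (simp add: coin_def space_point_measure emeasure_point_measure_finite)
  also have "\<dots> = 1"
    using assms by (subst ennreal_plus[symmetric]) (auto simp: field_simps)
  finally show "emeasure (coin \<theta>) (space (coin \<theta>)) = 1" .
qed

text \<open>In round \<open>0\<close> the coin is deterministic whatever \<open>\<theta>\<close> is, so that this round creates a shift of
  the mean gradient but discloses nothing about \<open>\<theta>\<close>.\<close>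

definition bias :: "real \<Rightarrow> nat \<Rightarrow> real"
  where "bias \<theta> t = (if t = 0 then 1 else \<theta>)"

definition coin_adversary :: "real \<Rightarrow> real adversary"
  where "coin_adversary \<theta> t h = coin (bias \<theta> t)"

lemma bias_bound: "\<bar>\<theta>\<bar> \<le> 1 \<Longrightarrow> \<bar>bias \<theta> t\<bar> \<le> 1"
  by (simp add: bias_def)

lemma is_adversary_coin:
  "\<bar>\<theta>\<bar> \<le> 1 \<Longrightarrow> is_adversary X signs T (coin_adversary \<theta>)"
  by (auto simp: is_adversary_def coin_adversary_def[abs_def] space_prob_algebra sets_coin
      intro!: measurable_const prob_space_coin bias_bound)

text \<open>The density of the samples relative to a fair coin. The product starts at 1 because the
  coin of round 0 is the same for all \<theta>.\<close>

definition likelihood :: "real \<Rightarrow> nat \<Rightarrow> (nat \<Rightarrow> real_seq \<times> real) \<Rightarrow> real"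
  where "likelihood \<theta> t h = (\<Prod>s\<in>{1..<t}. 1 + \<theta> * snd (h s))"

text \<open>Divided by \<open>1 - \<theta>\<^sup>2\<close>, this is the score, the derivative of the
  logarithm of the likelihood.\<close>

definition centred_sum :: "real \<Rightarrow> nat \<Rightarrow> (nat \<Rightarrow> real_seq \<times> real) \<Rightarrow> real"
  where "centred_sum \<theta> t h = (\<Sum>s\<in>{1..<t}. snd (h s) - \<theta>)"

lemma likelihood_Suc:
  "likelihood \<theta> (Suc t) (h(t := z)) = likelihood \<theta> t h * (if t = 0 then 1 else 1 + \<theta> * snd z)"
  by (simp add: likelihood_def prod.op_ivl_Suc)

lemma centred_sum_Suc:
  "centred_sum \<theta> (Suc t) (h(t := z)) = centred_sum \<theta> t h + (if t = 0 then 0 else snd z - \<theta>)"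
  by (simp add: centred_sum_def sum.op_ivl_Suc)

lemma sample_cases:
  assumes "h \<in> space (histories X signs t)" "s < t"
  shows "snd (h s) = 1 \<or> snd (h s) = - 1"
  using assms by (force simp: space_PiM PiE_iff space_pair_measure)

lemma sample_measurable:
  assumes "s < t"
  shows "(\<lambda>h. snd (h s)) \<in> borel_measurable (histories X signs t)"
proof -
  have "(\<lambda>h. h s) \<in> histories X signs t \<rightarrow>\<^sub>M actions X \<Otimes>\<^sub>M signs"
    using assms by (intro measurable_component_singleton) auto
  then have "(\<lambda>h. snd (h s)) \<in> histories X signs t \<rightarrow>\<^sub>M signs"
    by (rule measurable_compose[OF _ measurable_snd])
  then show ?thesis
    by (rule measurable_compose) simp
qed

text \<open>Joint measurability in bias and history is what Fubini's theorem asks for in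
  \<open>van_trees_uniform_prior\<close>.\<close>

lemma likelihood_measurable_pair:
  "(\<lambda>(\<theta>, h). likelihood \<theta> t h) \<in> borel_measurable (borel \<Otimes>\<^sub>M histories X signs t)"
  unfolding likelihood_def case_prod_beta
  by (intro borel_measurable_prod borel_measurable_add borel_measurable_times borel_measurable_const
      measurable_fst measurable_compose[OF measurable_snd sample_measurable]) auto

lemma centred_sum_measurable_pair:
  "(\<lambda>(\<theta>, h). centred_sum \<theta> t h) \<in> borel_measurable (borel \<Otimes>\<^sub>M histories X signs t)"
  unfolding centred_sum_def case_prod_beta
  by (intro borel_measurable_sum borel_measurable_diff borel_measurable_const
      measurable_fst measurable_compose[OF measurable_snd sample_measurable]) auto

lemma likelihood_measurable: "likelihood \<theta> t \<in> borel_measurable (histories X signs t)"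
  using measurable_Pair2[OF likelihood_measurable_pair, of \<theta>] by simp

lemma centred_sum_measurable: "centred_sum \<theta> t \<in> borel_measurable (histories X signs t)"
  using measurable_Pair2[OF centred_sum_measurable_pair, of \<theta>] by simp

text \<open>The upper bound serves integrability only, so its growth in t does no harm.\<close>

lemma likelihood_bounds:
  assumes h: "h \<in> space (histories X signs t)" and \<theta>: "\<bar>\<theta>\<bar> \<le> 1"
  shows "0 \<le> likelihood \<theta> t h" "likelihood \<theta> t h \<le> 2 ^ t"
proof -
  have "0 \<le> 1 + \<theta> * snd (h s)" "1 + \<theta> * snd (h s) \<le> 2" if "s \<in> {1..<t}" for s
    using sample_cases[OF h, of s] that \<theta> by auto
  note b = this
  show "0 \<le> likelihood \<theta> t h"
    unfolding likelihood_def by (rule prod_nonneg) (use b in auto)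
  have "likelihood \<theta> t h \<le> (\<Prod>s\<in>{1..<t}. 2)"
    unfolding likelihood_def by (rule prod_mono) (use b in auto)
  also have "\<dots> \<le> 2 ^ t" by (simp add: power_increasing)
  finally show "likelihood \<theta> t h \<le> 2 ^ t" .
qed

lemma centred_sum_bound:
  assumes h: "h \<in> space (histories X signs t)" and \<theta>: "\<bar>\<theta>\<bar> \<le> 1"
  shows "\<bar>centred_sum \<theta> t h\<bar> \<le> 2 * t"
proof -
  have "\<bar>centred_sum \<theta> t h\<bar> \<le> (\<Sum>s\<in>{1..<t}. \<bar>snd (h s) - \<theta>\<bar>)"
    unfolding centred_sum_def by (rule sum_abs)
  also have "\<dots> \<le> (\<Sum>s\<in>{1..<t}. 2)"
    using sample_cases[OF h] \<theta> by (intro sum_mono) fastforce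
  also have "\<dots> \<le> 2 * t" by simp
  finally show ?thesis .
qed

section \<open>A fixed learner against coins: change of measure and moments\<close>

locale coin_game =
  fixes X :: "real_seq set" and a :: "real learner" and T :: nat
  assumes learner: "is_learner X signs T a"
begin

abbreviation "hist \<equiv> histories X signs"
abbreviation "coin_law \<theta> \<equiv> joint_law X signs a (coin_adversary \<theta>)"

lemma interaction_coin: "\<bar>\<theta>\<bar> \<le> 1 \<Longrightarrow> interaction X signs a (coin_adversary \<theta>) T"
  using learner is_adversary_coin by unfold_locales

lemma step_integral_coin:
  fixes \<phi> :: "(nat \<Rightarrow> real_seq \<times> real) \<Rightarrow> real"
  assumes \<theta>: "\<bar>\<theta>\<bar> \<le> 1" and t: "t < T" and h: "h \<in> space (hist t)"
    and m: "\<phi> \<in> borel_measurable (hist (Suc t))"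
    and b: "\<And>h. h \<in> space (hist (Suc t)) \<Longrightarrow> \<bar>\<phi> h\<bar> \<le> B"
  shows "(\<integral>z. \<phi> (h(t := z)) \<partial>(a t h \<Otimes>\<^sub>M coin_adversary \<theta> t h))
    = (\<integral>x. (1 + bias \<theta> t) / 2 * \<phi> (h(t := (x, 1)))
        + (1 - bias \<theta> t) / 2 * \<phi> (h(t := (x, - 1))) \<partial>a t h)"
proof -
  interpret interaction X signs a "coin_adversary \<theta>" T
    by (rule interaction_coin[OF \<theta>])
  interpret A: prob_space "a t h" using learner_dist h t by auto
  interpret B: prob_space "coin_adversary \<theta> t h" using adversary_dist h t by auto
  interpret pair_prob_space "a t h" "coin_adversary \<theta> t h" ..
  show ?thesis
    using integral_fst'[OF step_integral_bound(1)[OF t h m b]]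
      integral_coin[OF bias_bound[OF \<theta>]]
    by (simp add: coin_adversary_def)
qed

text \<open>In each round after the first the two games differ by the factor 1 + \<theta> \<epsilon>
  on the outcome \<epsilon>, while the learner's kernel is common to both. These factors multiply up
  to the likelihood.\<close>

lemma change_of_measure:
  assumes \<theta>: "\<bar>\<theta>\<bar> \<le> 1"
  shows "t \<le> T \<Longrightarrow> \<phi> \<in> borel_measurable (hist t) \<Longrightarrow> (\<And>h. h \<in> space (hist t) \<Longrightarrow> \<bar>\<phi> h\<bar> \<le> B)
    \<Longrightarrow> (\<integral>h. \<phi> h \<partial>coin_law \<theta> t) = (\<integral>h. \<phi> h * likelihood \<theta> t h \<partial>coin_law 0 t)"
proof (induction t arbitrary: \<phi>)
  case 0
  show ?case by (simp add: likelihood_def)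
next
  case (Suc t)
  interpret I: interaction X signs a "coin_adversary \<theta>" T
    by (rule interaction_coin[OF \<theta>])
  interpret J: interaction X signs a "coin_adversary 0" T
    by (rule interaction_coin) simp
  have t: "t < T" using Suc by simp
  note m = Suc.prems(2) and b = Suc.prems(3)
  let ?\<psi> = "\<lambda>h. \<phi> h * likelihood \<theta> (Suc t) h"
  have m': "?\<psi> \<in> borel_measurable (hist (Suc t))"
    by (intro borel_measurable_times m likelihood_measurable)
  have b': "\<bar>?\<psi> h\<bar> \<le> B * 2 ^ Suc t" if "h \<in> space (hist (Suc t))" for h
    using b[OF that] likelihood_bounds[OF that \<theta>] unfolding abs_mult
    by (intro mult_mono) auto
  have "(\<integral>h. \<phi> h \<partial>coin_law \<theta> (Suc t))
      = (\<integral>h. (\<integral>z. \<phi> (h(t := z)) \<partial>(a t h \<Otimes>\<^sub>M coin_adversary \<theta> t h)) \<partial>coin_law \<theta> t)"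
    by (rule I.integral_joint_law_Suc[OF t m b])
  \<comment> \<open>The one-step integral is itself a bounded measurable function of the shorter
    history; to apply the induction hypothesis to it, \<phi> has to be arbitrary.\<close>
  also have "\<dots> = (\<integral>h. (\<integral>z. \<phi> (h(t := z)) \<partial>(a t h \<Otimes>\<^sub>M coin_adversary \<theta> t h))
      * likelihood \<theta> t h \<partial>coin_law 0 t)"
    by (rule Suc.IH) (use t I.step_integral_measurable[OF t m] I.step_integral_bound(2)[OF t _ m b] in auto)
  also have "\<dots> = (\<integral>h. (\<integral>z. ?\<psi> (h(t := z)) \<partial>(a t h \<Otimes>\<^sub>M coin_adversary 0 t h)) \<partial>coin_law 0 t)"
  proof (rule Bochner_Integration.integral_cong)
    fix h assume "h \<in> space (coin_law 0 t)"
    then have h: "h \<in> space (hist t)" using t by (simp add: J.space_joint_law)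
    show "(\<integral>z. \<phi> (h(t := z)) \<partial>(a t h \<Otimes>\<^sub>M coin_adversary \<theta> t h)) * likelihood \<theta> t h
        = (\<integral>z. ?\<psi> (h(t := z)) \<partial>(a t h \<Otimes>\<^sub>M coin_adversary 0 t h))"
    proof -
      have "(\<integral>z. \<phi> (h(t := z)) \<partial>(a t h \<Otimes>\<^sub>M coin_adversary \<theta> t h)) * likelihood \<theta> t h
          = (\<integral>x. ((1 + bias \<theta> t) / 2 * \<phi> (h(t := (x, 1)))
              + (1 - bias \<theta> t) / 2 * \<phi> (h(t := (x, - 1)))) * likelihood \<theta> t h \<partial>a t h)"
        by (subst step_integral_coin[OF \<theta> t h m b]) (simp_all only: integral_mult_left_zero)
      \<comment> \<open>For t = 0 both biases are 1 and the likelihood gains no factor; later the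
        new factor turns the weights 1/2 into those of bias \<theta>.\<close>
      also have "\<dots> = (\<integral>x. (1 + bias 0 t) / 2 * ?\<psi> (h(t := (x, 1)))
          + (1 - bias 0 t) / 2 * ?\<psi> (h(t := (x, - 1))) \<partial>a t h)"
        by (intro Bochner_Integration.integral_cong refl)
          (auto simp: likelihood_Suc bias_def field_simps)
      also have "\<dots> = (\<integral>z. ?\<psi> (h(t := z)) \<partial>(a t h \<Otimes>\<^sub>M coin_adversary 0 t h))"
        by (rule step_integral_coin[OF _ t h m' b', symmetric]) simp
      finally show ?thesis .
    qed
  qed simp
  also have "\<dots> = (\<integral>h. ?\<psi> h \<partial>coin_law 0 (Suc t))"
    by (rule J.integral_joint_law_Suc[OF t m' b', symmetric])
  finally show ?case .
qed

text \<open>The centred samples are martingale increments of conditional variance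
  \<open>1 - \<theta>\<^sup>2\<close>, so the cross terms vanish. Only rounds from 1 on contribute,
  hence \<open>t - 1\<close>. The affine form makes the square of \<open>weighted_score\<close> an
  instance.\<close>

lemma integral_affine_centred_sum_sq:
  assumes \<theta>: "\<bar>\<theta>\<bar> \<le> 1"
  shows "t \<le> T \<Longrightarrow> (\<integral>h. (\<alpha> + \<beta> * centred_sum \<theta> t h)\<^sup>2 \<partial>coin_law \<theta> t)
    = \<alpha>\<^sup>2 + \<beta>\<^sup>2 * real (t - 1) * (1 - \<theta>\<^sup>2)"
proof (induction t)
  interpret interaction X signs a "coin_adversary \<theta>" T
    by (rule interaction_coin[OF \<theta>])
  {
    case 0
    show ?case
      using prob_space.prob_space[OF prob_space_joint_law[of 0]] by (simp add: centred_sum_def)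
  next
    case (Suc t)
    then have t: "t < T" by simp
    let ?\<phi> = "\<lambda>h. (\<alpha> + \<beta> * centred_sum \<theta> (Suc t) h)\<^sup>2"
    let ?g = "\<lambda>h. (\<alpha> + \<beta> * centred_sum \<theta> t h)\<^sup>2"
    have m: "?\<phi> \<in> borel_measurable (hist (Suc t))" "?g \<in> borel_measurable (hist t)"
      by (intro borel_measurable_power borel_measurable_add borel_measurable_times
          borel_measurable_const centred_sum_measurable)+
    have b: "\<bar>(\<alpha> + \<beta> * centred_sum \<theta> n h)\<^sup>2\<bar> \<le> (\<bar>\<alpha>\<bar> + \<bar>\<beta>\<bar> * (2 * n))\<^sup>2"
      if "h \<in> space (hist n)" for h n
    proof -
      have "\<bar>\<alpha> + \<beta> * centred_sum \<theta> n h\<bar> \<le> \<bar>\<alpha>\<bar> + \<bar>\<beta>\<bar> * (2 * n)"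
        using mult_left_mono[OF centred_sum_bound[OF that \<theta>], of "\<bar>\<beta>\<bar>"]
        by (intro order_trans[OF abs_triangle_ineq]) (simp add: abs_mult)
      then show ?thesis
        by (metis abs_ge_zero power_abs power_mono)
    qed
    have "(\<integral>h. ?\<phi> h \<partial>coin_law \<theta> (Suc t))
        = (\<integral>h. (\<integral>z. ?\<phi> (h(t := z)) \<partial>(a t h \<Otimes>\<^sub>M coin_adversary \<theta> t h)) \<partial>coin_law \<theta> t)"
      by (rule integral_joint_law_Suc[OF t m(1) b])
    also have "\<dots> = (\<integral>h. ?g h + (if t = 0 then 0 else \<beta>\<^sup>2 * (1 - \<theta>\<^sup>2)) \<partial>coin_law \<theta> t)"
    proof (rule Bochner_Integration.integral_cong)
      fix h assume "h \<in> space (coin_law \<theta> t)"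
      then have h: "h \<in> space (hist t)" using t by (simp add: space_joint_law)
      interpret A: prob_space "a t h" using learner_dist h t by auto
      show "(\<integral>z. ?\<phi> (h(t := z)) \<partial>(a t h \<Otimes>\<^sub>M coin_adversary \<theta> t h))
          = ?g h + (if t = 0 then 0 else \<beta>\<^sup>2 * (1 - \<theta>\<^sup>2))"
      proof -
        have "(1 + \<theta>) / 2 * (\<alpha> + \<beta> * (c + (1 - \<theta>)))\<^sup>2 + (1 - \<theta>) / 2 * (\<alpha> + \<beta> * (c + (- 1 - \<theta>)))\<^sup>2
            = (\<alpha> + \<beta> * c)\<^sup>2 + \<beta>\<^sup>2 * (1 - \<theta>\<^sup>2)" for c
          by (simp add: field_simps power2_eq_square)
        then show ?thesis
          using A.prob_space by (subst step_integral_coin[OF \<theta> t h m(1) b])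
            (auto simp: centred_sum_Suc bias_def)
      qed
    qed simp
    also have "\<dots> = \<alpha>\<^sup>2 + \<beta>\<^sup>2 * real (t - 1) * (1 - \<theta>\<^sup>2) + (if t = 0 then 0 else \<beta>\<^sup>2 * (1 - \<theta>\<^sup>2))"
    proof -
      interpret P: prob_space "coin_law \<theta> t" using prob_space_joint_law t by simp
      have "integrable (coin_law \<theta> t) ?g"
        using t by (intro integrable_joint_law[OF _ m(2) b]) auto
      then show ?thesis using Suc by (simp add: P.prob_space)
    qed
    finally show ?case by (cases t) (auto simp: algebra_simps)
  }
qed

text \<open>Given the past, action and sample of a round are independent, and the sample has mean
  \<theta>. This removes the linear term of the excess loss.\<close>

lemma integral_centred_sample:
  fixes \<psi> :: "real_seq \<Rightarrow> real"
  assumes \<theta>: "\<bar>\<theta>\<bar> \<le> 1" and t: "t < T" "0 < t" and m: "\<psi> \<in> borel_measurable (actions X)"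
    and b: "\<And>x. x \<in> X \<Longrightarrow> \<bar>\<psi> x\<bar> \<le> B"
  shows "(\<integral>h. (snd (h t) - \<theta>) * \<psi> (fst (h t)) \<partial>coin_law \<theta> (Suc t)) = 0"
proof -
  interpret interaction X signs a "coin_adversary \<theta>" T
    by (rule interaction_coin[OF \<theta>])
  define \<phi> where "\<phi> = (\<lambda>h :: nat \<Rightarrow> real_seq \<times> real. (snd (h t) - \<theta>) * \<psi> (fst (h t)))"
  have c: "(\<lambda>h. h t) \<in> hist (Suc t) \<rightarrow>\<^sub>M actions X \<Otimes>\<^sub>M signs"
    by (intro measurable_component_singleton) auto
  have "(\<lambda>h. \<psi> (fst (h t))) \<in> borel_measurable (hist (Suc t))"
    by (rule measurable_compose[OF c measurable_compose[OF measurable_fst m]])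
  moreover have "(\<lambda>h. snd (h t)) \<in> borel_measurable (hist (Suc t))"
    by (rule sample_measurable) simp
  ultimately have m': "\<phi> \<in> borel_measurable (hist (Suc t))"
    unfolding \<phi>_def
    by (intro borel_measurable_times borel_measurable_diff borel_measurable_const)
  have b': "\<bar>\<phi> h\<bar> \<le> 2 * B" if h: "h \<in> space (hist (Suc t))" for h
  proof -
    have "fst (h t) \<in> X"
      using action_in_domain[OF h] by simp
    then show ?thesis
      using sample_cases[OF h, of t] \<theta> b[of "fst (h t)"] unfolding \<phi>_def abs_mult
      by (intro mult_mono; force)
  qed
  have "(\<integral>h. \<phi> h \<partial>coin_law \<theta> (Suc t))
      = (\<integral>h. (\<integral>z. \<phi> (h(t := z)) \<partial>(a t h \<Otimes>\<^sub>M coin_adversary \<theta> t h)) \<partial>coin_law \<theta> t)"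
    by (rule integral_joint_law_Suc[OF t(1) m' b'])
  also have "\<dots> = (\<integral>h. 0 \<partial>coin_law \<theta> t)"
  proof (rule Bochner_Integration.integral_cong)
    fix h assume "h \<in> space (coin_law \<theta> t)"
    then have h: "h \<in> space (hist t)" using t by (simp add: space_joint_law)
    have z: "(1 + bias \<theta> t) / 2 * \<phi> (h(t := (x, 1)))
        + (1 - bias \<theta> t) / 2 * \<phi> (h(t := (x, - 1))) = 0" for x
      using t(2) by (simp add: bias_def \<phi>_def field_simps)
    show "(\<integral>z. \<phi> (h(t := z)) \<partial>(a t h \<Otimes>\<^sub>M coin_adversary \<theta> t h)) = 0"
      by (subst step_integral_coin[OF \<theta> t(1) h m' b']) (simp_all add: z del: times_divide_eq_left)
  qed simp
  finally show ?thesis by (simp add: \<phi>_def)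
qed

end

section \<open>A van Trees inequality\<close>

text \<open>For a sign \<epsilon>, \<open>\<epsilon> / (1 + \<theta> * \<epsilon>) = (\<epsilon> -
  \<theta>) / (1 - \<theta>\<^sup>2)\<close>, so the logarithmic derivatives of all factors share
  one denominator.\<close>

lemma likelihood_has_derivative:
  assumes h: "h \<in> space (histories X signs t)" and \<theta>: "\<bar>\<theta>\<bar> < 1"
  shows "((\<lambda>\<theta>. likelihood \<theta> t h) has_real_derivative
    likelihood \<theta> t h * centred_sum \<theta> t h / (1 - \<theta>\<^sup>2)) (at \<theta>)"
proof -
  have nz: "1 - \<theta>\<^sup>2 \<noteq> 0"
    using \<theta> by (simp add: abs_square_eq_1)
  have "((\<lambda>\<theta>. likelihood \<theta> n h) has_real_derivative
      likelihood \<theta> n h * centred_sum \<theta> n h / (1 - \<theta>\<^sup>2)) (at \<theta>)" if "n \<le> t" for n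
    using that
  proof (induction n)
    case 0
    show ?case by (simp add: likelihood_def centred_sum_def)
  next
    case (Suc n)
    show ?case
    proof (cases "n = 0")
      case True
      then show ?thesis by (simp add: likelihood_def centred_sum_def)
    next
      case False
      define \<epsilon> where "\<epsilon> = snd (h n)"
      have "\<epsilon>\<^sup>2 = 1" using sample_cases[OF h, of n] Suc by (auto simp: \<epsilon>_def)
      then have \<epsilon>: "\<epsilon> = (1 + \<theta> * \<epsilon>) * (\<epsilon> - \<theta>) / (1 - \<theta>\<^sup>2)"
        using nz by (simp add: field_simps power2_eq_square)
      have L: "likelihood \<eta> (Suc n) h = likelihood \<eta> n h * (1 + \<eta> * \<epsilon>)" for \<eta>
        using False by (simp add: likelihood_def \<epsilon>_def prod.op_ivl_Suc)
      have M: "centred_sum \<theta> (Suc n) h = centred_sum \<theta> n h + (\<epsilon> - \<theta>)"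
        using False by (simp add: centred_sum_def \<epsilon>_def sum.op_ivl_Suc)
      have "((\<lambda>\<theta>. likelihood \<theta> n h * (1 + \<theta> * \<epsilon>)) has_real_derivative
          likelihood \<theta> n h * centred_sum \<theta> n h / (1 - \<theta>\<^sup>2) * (1 + \<theta> * \<epsilon>)
            + likelihood \<theta> n h * \<epsilon>) (at \<theta>)"
        using Suc by (auto intro!: derivative_eq_intros)
      also have "likelihood \<theta> n h * centred_sum \<theta> n h / (1 - \<theta>\<^sup>2) * (1 + \<theta> * \<epsilon>)
            + likelihood \<theta> n h * \<epsilon>
          = likelihood \<theta> n h * (1 + \<theta> * \<epsilon>) * (centred_sum \<theta> n h + (\<epsilon> - \<theta>)) / (1 - \<theta>\<^sup>2)"
      proof -
        have "likelihood \<theta> n h * \<epsilon> = likelihood \<theta> n h * (1 + \<theta> * \<epsilon>) * (\<epsilon> - \<theta>) / (1 - \<theta>\<^sup>2)"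
          using \<epsilon> by (metis mult.assoc times_divide_eq_right)
        then show ?thesis
          by (simp add: distrib_left add_divide_distrib mult_ac)
      qed
      finally show ?thesis by (simp add: L M)
    qed
  qed
  then show ?thesis by simp
qed

text \<open>The factor \<open>r\<^sup>2 - \<theta>\<^sup>2\<close> vanishes at both ends of the
  prior interval and so removes the boundary terms of the integration by parts.\<close>

definition prior_weight :: "real \<Rightarrow> real \<Rightarrow> real"
  where "prior_weight r \<theta> = (1 - \<theta>\<^sup>2) * (r\<^sup>2 - \<theta>\<^sup>2)"

definition prior_weight_deriv :: "real \<Rightarrow> real \<Rightarrow> real"
  where "prior_weight_deriv r \<theta> = - 2 * \<theta> * (r\<^sup>2 - \<theta>\<^sup>2) - 2 * \<theta> * (1 - \<theta>\<^sup>2)"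

text \<open>The derivative of \<open>\<theta> \<mapsto> prior_weight r \<theta> * likelihood \<theta> t h\<close>, divided by the likelihood.  The
  factor \<open>1 - \<theta>\<^sup>2\<close> of the weight cancels the denominator of the score of the coin.\<close>

definition weighted_score :: "real \<Rightarrow> real \<Rightarrow> nat \<Rightarrow> (nat \<Rightarrow> real_seq \<times> real) \<Rightarrow> real"
  where "weighted_score r \<theta> t h = prior_weight_deriv r \<theta> + (r\<^sup>2 - \<theta>\<^sup>2) * centred_sum \<theta> t h"

lemma weighted_likelihood_has_derivative:
  assumes h: "h \<in> space (histories X signs t)" and \<theta>: "\<bar>\<theta>\<bar> < 1"
  shows "((\<lambda>\<theta>. prior_weight r \<theta> * likelihood \<theta> t h) has_real_derivative
    weighted_score r \<theta> t h * likelihood \<theta> t h) (at \<theta>)"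
proof -
  have nz: "1 - \<theta>\<^sup>2 \<noteq> 0"
    using \<theta> by (simp add: abs_square_eq_1)
  have "(prior_weight r has_real_derivative prior_weight_deriv r \<theta>) (at \<theta>)"
    unfolding prior_weight_def prior_weight_deriv_def
    by (auto intro!: derivative_eq_intros simp: algebra_simps power2_eq_square)
  from DERIV_cong[OF DERIV_mult[OF this likelihood_has_derivative[OF h \<theta>]]] show ?thesis
    using nz by (simp add: weighted_score_def prior_weight_def field_simps)
qed

lemma continuous_likelihood: "continuous_on S (\<lambda>\<theta>. likelihood \<theta> t h)"
  unfolding likelihood_def by (intro continuous_intros)

lemma continuous_centred_sum: "continuous_on S (\<lambda>\<theta>. centred_sum \<theta> t h)"
  unfolding centred_sum_def by (intro continuous_intros)

lemma continuous_weighted_score: "continuous_on S (\<lambda>\<theta>. weighted_score r \<theta> t h)"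
  unfolding weighted_score_def prior_weight_deriv_def
  by (intro continuous_intros continuous_centred_sum)

section \<open>Integrals over the uniform prior, which is left unnormalized with mass 2 r\<close>

abbreviation prior :: "real \<Rightarrow> real measure"
  where "prior r \<equiv> restrict_space lborel {- r..r}"

lemma finite_measure_prior: "finite_measure (prior r)"
  by (rule finite_measureI) (simp add: space_restrict_space emeasure_restrict_space emeasure_lborel_Icc_eq)

lemma borel_measurable_prior: "f \<in> borel_measurable borel \<Longrightarrow> f \<in> borel_measurable (prior r)"
  by (rule measurable_restrict_space1) simp

lemma integrable_prior:
  fixes f :: "real \<Rightarrow> real"
  assumes "continuous_on {- r..r} f"
  shows "integrable (prior r) f"
  using borel_integrable_compact[OF _ assms]
  by (subst integrable_restrict_space) (auto simp: set_integrable_def)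

lemma integral_prior_FTC:
  fixes f :: "real \<Rightarrow> real"
  assumes "0 \<le> r" and "\<And>\<theta>. \<bar>\<theta>\<bar> \<le> r \<Longrightarrow> (F has_real_derivative f \<theta>) (at \<theta>)"
    and "continuous_on {- r..r} f"
  shows "integral\<^sup>L (prior r) f = F r - F (- r)"
proof -
  have "integral\<^sup>L (prior r) f = (\<integral>\<theta>. indicator {- r..r} \<theta> *\<^sub>R f \<theta> \<partial>lborel)"
    by (rule integral_restrict_space) simp
  also have "\<dots> = F r - F (- r)"
  proof (rule integral_FTC_Icc)
    fix \<theta> assume "- r \<le> \<theta>" "\<theta> \<le> r"
    then have "(F has_real_derivative f \<theta>) (at \<theta>)"
      by (intro assms(2)) simp
    then show "(F has_vector_derivative f \<theta>) (at \<theta> within {- r..r})"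
      unfolding has_real_derivative_iff_has_vector_derivative
      by (rule has_vector_derivative_at_within)
  qed (use assms in auto)
  finally show ?thesis .
qed

text \<open>On the interval \<open>1 - \<theta>\<^sup>2\<close> is at least 3/4, and the other
  factor of the weight integrates to 4/3 times the cube of r.\<close>

lemma integral_prior_weight:
  assumes "0 \<le> r" "r \<le> 1 / 2"
  shows "r ^ 3 \<le> (\<integral>\<theta>. prior_weight r \<theta> \<partial>prior r)"
proof -
  have "(\<integral>\<theta>. 3 / 4 * (r\<^sup>2 - \<theta>\<^sup>2) \<partial>prior r)
      = 3 / 4 * (r\<^sup>2 * r - r ^ 3 / 3) - 3 / 4 * (r\<^sup>2 * (- r) - (- r) ^ 3 / 3)"
    using assms(1)
    by (rule integral_prior_FTC) (auto intro!: derivative_eq_intros continuous_intros)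
  also have "\<dots> = r ^ 3"
    by (simp add: power2_eq_square power3_eq_cube)
  finally have "r ^ 3 = (\<integral>\<theta>. 3 / 4 * (r\<^sup>2 - \<theta>\<^sup>2) \<partial>prior r)" ..
  also have "\<dots> \<le> (\<integral>\<theta>. prior_weight r \<theta> \<partial>prior r)"
  proof (rule integral_mono)
    show "integrable (prior r) (\<lambda>\<theta>. 3 / 4 * (r\<^sup>2 - \<theta>\<^sup>2))" "integrable (prior r) (prior_weight r)"
      unfolding prior_weight_def by (intro integrable_prior continuous_intros)+
    fix \<theta> assume "\<theta> \<in> space (prior r)"
    then have "\<bar>\<theta>\<bar> \<le> r" by auto
    then have "\<theta>\<^sup>2 \<le> r\<^sup>2" "\<theta>\<^sup>2 \<le> 1 / 4"
      using power_mono[of "\<bar>\<theta>\<bar>" r 2] power_mono[of "\<bar>\<theta>\<bar>" "1 / 2" 2] assms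
      by (auto simp: power2_eq_square[of "2::real"] power_divide)
    then show "3 / 4 * (r\<^sup>2 - \<theta>\<^sup>2) \<le> prior_weight r \<theta>"
      unfolding prior_weight_def by (intro mult_right_mono) auto
  qed
  finally show ?thesis .
qed

text \<open>The left side is the second moment of \<open>weighted_score\<close> after n samples,
  split into the share of the weight and that of the samples. Each is at most
  \<open>n * r ^ 4\<close>; for the first this needs enough samples, which is the last
  hypothesis.\<close>

lemma information_bound:
  assumes r: "0 < r" "r \<le> 1 / 2" and \<theta>: "\<bar>\<theta>\<bar> \<le> r" and n: "7 \<le> n * r\<^sup>2"
  shows "(prior_weight_deriv r \<theta>)\<^sup>2 + (r\<^sup>2 - \<theta>\<^sup>2)\<^sup>2 * n * (1 - \<theta>\<^sup>2) \<le> 2 * n * r ^ 4"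
proof -
  have t: "\<theta>\<^sup>2 \<le> r\<^sup>2" and r2: "r\<^sup>2 \<le> 1 / 4"
    using \<theta> r power_mono[of "\<bar>\<theta>\<bar>" r 2] power_mono[of r "1 / 2" 2] by (auto simp: power_divide)
  have n0: "0 \<le> n"
    using n mult_nonpos_nonneg[of n "r\<^sup>2"] by fastforce
  have "(r\<^sup>2 - \<theta>\<^sup>2) + (1 - \<theta>\<^sup>2) \<le> 5 / 4" "0 \<le> (r\<^sup>2 - \<theta>\<^sup>2) + (1 - \<theta>\<^sup>2)"
    using t r2 zero_le_power2[of \<theta>] by linarith+
  then have "((r\<^sup>2 - \<theta>\<^sup>2) + (1 - \<theta>\<^sup>2))\<^sup>2 \<le> (5 / 4)\<^sup>2"
    by (rule power_mono)
  \<comment> \<open>25/16 is rounded up to 7/4, and 4 times 7/4 is the 7 of the hypothesis on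
    n.\<close>
  also have "\<dots> \<le> (7 / 4 :: real)"
    by (simp add: power2_eq_square)
  finally have "4 * \<theta>\<^sup>2 * ((r\<^sup>2 - \<theta>\<^sup>2) + (1 - \<theta>\<^sup>2))\<^sup>2 \<le> 4 * r\<^sup>2 * (7 / 4)"
    using t by (intro mult_mono) auto
  moreover have "(prior_weight_deriv r \<theta>)\<^sup>2 = 4 * \<theta>\<^sup>2 * ((r\<^sup>2 - \<theta>\<^sup>2) + (1 - \<theta>\<^sup>2))\<^sup>2"
    by (simp add: prior_weight_deriv_def power2_eq_square algebra_simps)
  ultimately have "(prior_weight_deriv r \<theta>)\<^sup>2 \<le> 7 * r\<^sup>2"
    by simp
  also have "\<dots> \<le> n * r\<^sup>2 * r\<^sup>2"
    using n by (intro mult_right_mono) auto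
  finally have 1: "(prior_weight_deriv r \<theta>)\<^sup>2 \<le> n * r ^ 4"
    by (simp add: power2_eq_square power4_eq_xxxx mult.assoc)
  have "(r\<^sup>2 - \<theta>\<^sup>2)\<^sup>2 * n * (1 - \<theta>\<^sup>2) \<le> (r\<^sup>2)\<^sup>2 * n * 1"
    using t r2 n0 zero_le_power2[of \<theta>] by (intro mult_mono power_mono mult_nonneg_nonneg) auto
  with 1 show ?thesis by (simp add: algebra_simps flip: power_mult)
qed

lemma weighted_score_bound:
  assumes h: "h \<in> space (histories X signs t)" and r: "0 < r" "r \<le> 1 / 2" and \<theta>: "\<bar>\<theta>\<bar> \<le> r"
  shows "\<bar>prior_weight r \<theta>\<bar> \<le> 1" "\<bar>weighted_score r \<theta> t h\<bar> \<le> 2 + 2 * real t"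
proof -
  have t: "\<theta>\<^sup>2 \<le> r\<^sup>2" "r\<^sup>2 \<le> 1 / 4"
    using \<theta> r power_mono[of "\<bar>\<theta>\<bar>" r 2] power_mono[of r "1 / 2" 2] by (auto simp: power_divide)
  have q: "\<bar>r\<^sup>2 - \<theta>\<^sup>2\<bar> \<le> 1" "\<bar>1 - \<theta>\<^sup>2\<bar> \<le> 1" "\<bar>(r\<^sup>2 - \<theta>\<^sup>2) + (1 - \<theta>\<^sup>2)\<bar> \<le> 2"
    using t zero_le_power2[of \<theta>] by linarith+
  show "\<bar>prior_weight r \<theta>\<bar> \<le> 1"
    unfolding prior_weight_def abs_mult using mult_mono[OF q(2) q(1)] by simp
  have "prior_weight_deriv r \<theta> = (- 2 * \<theta>) * ((r\<^sup>2 - \<theta>\<^sup>2) + (1 - \<theta>\<^sup>2))"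
    by (simp add: prior_weight_deriv_def algebra_simps)
  then have "\<bar>prior_weight_deriv r \<theta>\<bar> = 2 * (\<bar>\<theta>\<bar> * \<bar>(r\<^sup>2 - \<theta>\<^sup>2) + (1 - \<theta>\<^sup>2)\<bar>)"
    by (simp add: abs_mult)
  also have "\<dots> \<le> 2 * (1 / 2 * 2)"
    using q \<theta> r by (intro mult_left_mono mult_mono) auto
  finally have "\<bar>prior_weight_deriv r \<theta>\<bar> \<le> 2" by simp
  moreover have "\<bar>(r\<^sup>2 - \<theta>\<^sup>2) * centred_sum \<theta> t h\<bar> \<le> 1 * (2 * real t)"
    unfolding abs_mult using q(1) centred_sum_bound[OF h, of \<theta>] \<theta> r by (intro mult_mono) auto
  ultimately show "\<bar>weighted_score r \<theta> t h\<bar> \<le> 2 + 2 * real t"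
    unfolding weighted_score_def by linarith
qed

text \<open>After adding a multiple of a function of \<open>\<theta>\<close> with vanishing integral, the difference of the
  two integrands is a perfect square times the likelihood.\<close>

lemma integral_prior_completed_square:
  assumes h: "h \<in> space (histories X signs t)" and r: "0 < r" "r \<le> 1 / 2"
  shows "(\<integral>\<theta>. (2 * l * prior_weight r \<theta> - l\<^sup>2 * (weighted_score r \<theta> t h)\<^sup>2) * likelihood \<theta> t h \<partial>prior r)
    \<le> (\<integral>\<theta>. (y - \<theta>)\<^sup>2 * likelihood \<theta> t h \<partial>prior r)"
proof -
  let ?L = "\<lambda>\<theta>. likelihood \<theta> t h" and ?g = "\<lambda>\<theta>. weighted_score r \<theta> t h"
  let ?w = "prior_weight r"
  have cw: "continuous_on S ?w" for S
    unfolding prior_weight_def by (intro continuous_intros)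
  note cont = continuous_intros cw continuous_likelihood continuous_weighted_score
  let ?K = "\<lambda>\<theta>. (2 * l * ?w \<theta> - l\<^sup>2 * (?g \<theta>)\<^sup>2) * ?L \<theta>"
  let ?F = "\<lambda>\<theta>. (y - \<theta>)\<^sup>2 * ?L \<theta>"
  \<comment> \<open>The derivative of \<open>(y - \<theta>) * (?w \<theta> * ?L \<theta>)\<close>:
    for a fixed history the estimate y is a number independent of \<theta>. As the weight is 0 at r
    and at - r, this derivative integrates to 0.\<close>
  let ?d = "\<lambda>\<theta>. (y - \<theta>) * (?g \<theta> * ?L \<theta>) - ?w \<theta> * ?L \<theta>"
  have int: "integrable (prior r) ?K" "integrable (prior r) ?F" "integrable (prior r) ?d"
    by (intro integrable_prior cont)+
  have "integral\<^sup>L (prior r) ?d = (y - r) * (?w r * ?L r) - (y - (- r)) * (?w (- r) * ?L (- r))"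
  proof (rule integral_prior_FTC)
    fix \<theta> assume "\<bar>\<theta>\<bar> \<le> r"
    then have "\<bar>\<theta>\<bar> < 1" using r by simp
    note deriv = weighted_likelihood_has_derivative[OF h this, of r]
    have "((\<lambda>\<theta>. y - \<theta>) has_real_derivative - 1) (at \<theta>)"
      by (auto intro!: derivative_eq_intros)
    from DERIV_cong[OF DERIV_mult[OF this deriv]]
    show "((\<lambda>\<theta>. (y - \<theta>) * (?w \<theta> * ?L \<theta>)) has_real_derivative ?d \<theta>) (at \<theta>)"
      by (simp add: mult.commute)
  next
    show "continuous_on {- r..r} ?d" by (intro cont)
  qed (use r in simp)
  also have "\<dots> = 0" by (simp add: prior_weight_def)
  finally have "integral\<^sup>L (prior r) ?F - integral\<^sup>L (prior r) ?K
      = (\<integral>\<theta>. ?F \<theta> - ?K \<theta> - 2 * l * ?d \<theta> \<partial>prior r)"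
    using int by simp
  also have "\<dots> = (\<integral>\<theta>. (y - \<theta> - l * ?g \<theta>)\<^sup>2 * ?L \<theta> \<partial>prior r)"
    by (intro Bochner_Integration.integral_cong) (auto simp: power2_eq_square algebra_simps)
  also have "0 \<le> \<dots>"
    using likelihood_bounds(1)[OF h] r by (intro integral_nonneg_AE AE_I2) auto
  finally show ?thesis by simp
qed

context coin_game
begin

text \<open>The completed square bounds the risk below by twice l times the integral of the weight,
  minus the square of l times the integrated second moment of the score. With n informative samples
  and an interval of length 2 r this is at least
  \<open>2 * l * r ^ 3 - 4 * l\<^sup>2 * n * r ^ 5\<close>, which is largest at the l chosen
  below.\<close>

lemma van_trees_uniform_prior:
  assumes t: "t \<le> T" and r: "0 < r" "r \<le> 1 / 2" and n: "7 \<le> real (t - 1) * r\<^sup>2"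
    and m: "y \<in> borel_measurable (hist t)" and b: "\<And>h. h \<in> space (hist t) \<Longrightarrow> \<bar>y h\<bar> \<le> B"
  shows "integrable (prior r) (\<lambda>\<theta>. \<integral>h. (y h - \<theta>)\<^sup>2 \<partial>coin_law \<theta> t)"
    and "r / (4 * real (t - 1)) \<le> (\<integral>\<theta>. (\<integral>h. (y h - \<theta>)\<^sup>2 \<partial>coin_law \<theta> t) \<partial>prior r)"
proof -
  let ?P = "coin_law 0 t" and ?n = "real (t - 1)"
  define l where "l = 1 / (4 * ?n * r\<^sup>2)"
  define F where "F \<theta> h = (y h - \<theta>)\<^sup>2 * likelihood \<theta> t h" for \<theta> h
  define K where "K \<theta> h = (2 * l * prior_weight r \<theta> - l\<^sup>2 * (weighted_score r \<theta> t h)\<^sup>2) * likelihood \<theta> t h"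
    for \<theta> h
  have n0: "0 < ?n" using n by (cases "t - 1") auto
  interpret J: interaction X signs a "coin_adversary 0" T
    by (rule interaction_coin) simp
  interpret P: prob_space ?P by (rule J.prob_space_joint_law[OF t])
  interpret U: finite_measure "prior r" by (rule finite_measure_prior)
  interpret pair_sigma_finite "prior r" ?P ..
  interpret Q: finite_measure "prior r \<Otimes>\<^sub>M ?P"
    by (rule finite_measure_pair_measure) unfold_locales
  have spP: "space ?P = space (hist t)" by (rule J.space_joint_law[OF t])
  have setsP: "sets ?P = sets (hist t)" by (rule J.sets_joint_law[OF t])
  have prior_le: "\<bar>\<theta>\<bar> \<le> r" "\<bar>\<theta>\<bar> \<le> 1" if "\<theta> \<in> space (prior r)" for \<theta>
    using that r by auto

  have fstm: "fst \<in> borel_measurable (prior r \<Otimes>\<^sub>M ?P)"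
    by (rule measurable_compose[OF measurable_fst borel_measurable_prior]) simp
  have "snd \<in> prior r \<Otimes>\<^sub>M ?P \<rightarrow>\<^sub>M ?P" by (rule measurable_snd)
  then have sndm: "snd \<in> prior r \<Otimes>\<^sub>M ?P \<rightarrow>\<^sub>M hist t"
    by (simp add: measurable_cong_sets[OF refl setsP])
  have pm: "(\<lambda>p. (fst p, snd p)) \<in> prior r \<Otimes>\<^sub>M ?P \<rightarrow>\<^sub>M borel \<Otimes>\<^sub>M hist t"
    by (rule measurable_Pair[OF fstm sndm])
  have Lm: "(\<lambda>p. likelihood (fst p) t (snd p)) \<in> borel_measurable (prior r \<Otimes>\<^sub>M ?P)"
    using measurable_compose[OF pm likelihood_measurable_pair] by simp
  have Cm: "(\<lambda>p. centred_sum (fst p) t (snd p)) \<in> borel_measurable (prior r \<Otimes>\<^sub>M ?P)"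
    using measurable_compose[OF pm centred_sum_measurable_pair] by simp
  have ym: "(\<lambda>p. y (snd p)) \<in> borel_measurable (prior r \<Otimes>\<^sub>M ?P)"
    by (rule measurable_compose[OF sndm m])
  have Fm: "case_prod F \<in> borel_measurable (prior r \<Otimes>\<^sub>M ?P)"
    unfolding F_def case_prod_beta'
    by (intro borel_measurable_times borel_measurable_power borel_measurable_diff Lm ym fstm)
  have Km: "case_prod K \<in> borel_measurable (prior r \<Otimes>\<^sub>M ?P)"
    unfolding K_def case_prod_beta' weighted_score_def prior_weight_def prior_weight_deriv_def
    by (intro borel_measurable_times borel_measurable_power borel_measurable_diff
        borel_measurable_add borel_measurable_const Lm Cm fstm)

  have Fb: "\<bar>F \<theta> h\<bar> \<le> (B + 1)\<^sup>2 * 2 ^ t" if "\<theta> \<in> space (prior r)" "h \<in> space (hist t)" for \<theta> h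
  proof -
    have "\<bar>y h - \<theta>\<bar> \<le> B + 1" using b[OF that(2)] prior_le[OF that(1)] by linarith
    then have "(y h - \<theta>)\<^sup>2 \<le> (B + 1)\<^sup>2"
      by (metis abs_ge_zero power2_abs power_mono)
    then show ?thesis
      using likelihood_bounds[OF that(2) prior_le(2)[OF that(1)]]
      unfolding F_def abs_mult by (intro mult_mono) auto
  qed
  have gb: "(weighted_score r \<theta> t h)\<^sup>2 \<le> (2 + 2 * real t)\<^sup>2"
    if "\<theta> \<in> space (prior r)" "h \<in> space (hist t)" for \<theta> h
    using weighted_score_bound(2)[OF that(2) r prior_le(1)[OF that(1)]]
    by (metis abs_ge_zero power2_abs power_mono)
  have \<phi>b: "\<bar>2 * l * prior_weight r \<theta> - l\<^sup>2 * (weighted_score r \<theta> t h)\<^sup>2\<bar>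
      \<le> 2 * \<bar>l\<bar> + l\<^sup>2 * (2 + 2 * real t)\<^sup>2"
    if "\<theta> \<in> space (prior r)" "h \<in> space (hist t)" for \<theta> h
  proof -
    have "\<bar>2 * l * prior_weight r \<theta>\<bar> \<le> 2 * \<bar>l\<bar> * 1"
      unfolding abs_mult
      using weighted_score_bound(1)[OF that(2) r prior_le(1)[OF that(1)]] by (intro mult_mono) auto
    moreover have "\<bar>l\<^sup>2 * (weighted_score r \<theta> t h)\<^sup>2\<bar> \<le> l\<^sup>2 * (2 + 2 * real t)\<^sup>2"
      using gb[OF that] by (simp add: abs_mult mult_left_mono)
    ultimately show ?thesis by linarith
  qed
  have Kb: "\<bar>K \<theta> h\<bar> \<le> (2 * \<bar>l\<bar> + l\<^sup>2 * (2 + 2 * real t)\<^sup>2) * 2 ^ t"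
    if "\<theta> \<in> space (prior r)" "h \<in> space (hist t)" for \<theta> h
    unfolding K_def abs_mult
    using \<phi>b[OF that] likelihood_bounds[OF that(2) prior_le(2)[OF that(1)]]
    by (intro mult_mono) auto
  have Fi: "integrable (prior r \<Otimes>\<^sub>M ?P) (case_prod F)"
    using Fm Fb by (intro Q.integrable_const_bound[where B = "(B + 1)\<^sup>2 * 2 ^ t"] AE_I2)
      (auto simp: space_pair_measure spP)
  have Ki: "integrable (prior r \<Otimes>\<^sub>M ?P) (case_prod K)"
    using Km Kb by (intro Q.integrable_const_bound[where
          B = "(2 * \<bar>l\<bar> + l\<^sup>2 * (2 + 2 * real t)\<^sup>2) * 2 ^ t"] AE_I2)
      (auto simp: space_pair_measure spP)

  \<comment> \<open>Moving every law to the fair coin makes the average over \<theta> an integral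
    over a product measure.\<close>
  have EF: "(\<integral>h. (y h - \<theta>)\<^sup>2 \<partial>coin_law \<theta> t) = (\<integral>h. F \<theta> h \<partial>?P)" if "\<theta> \<in> space (prior r)" for \<theta>
    unfolding F_def
  proof (rule change_of_measure[OF prior_le(2)[OF that] t])
    show "(\<lambda>h. (y h - \<theta>)\<^sup>2) \<in> borel_measurable (hist t)"
      by (intro borel_measurable_power borel_measurable_diff m borel_measurable_const)
    show "\<bar>(y h - \<theta>)\<^sup>2\<bar> \<le> (B + 1)\<^sup>2" if "h \<in> space (hist t)" for h
    proof -
      have "\<bar>y h - \<theta>\<bar> \<le> B + 1"
        using b[OF that] prior_le[OF \<open>\<theta> \<in> space (prior r)\<close>] by linarith
      then show ?thesis
        by (metis abs_ge_zero abs_power2 power2_abs power_mono)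
    qed
  qed
  show "integrable (prior r) (\<lambda>\<theta>. \<integral>h. (y h - \<theta>)\<^sup>2 \<partial>coin_law \<theta> t)"
    using integrable_fst[OF Fi] EF by (subst Bochner_Integration.integrable_cong[OF refl]) auto

  \<comment> \<open>Here the change of measure is read backwards: under bias \<theta> the second
    moment of the score is explicit.\<close>
  have EK: "2 * l * prior_weight r \<theta> - l\<^sup>2 * (2 * ?n * r ^ 4) \<le> (\<integral>h. K \<theta> h \<partial>?P)"
    if \<theta>: "\<theta> \<in> space (prior r)" for \<theta>
  proof -
    interpret I: interaction X signs a "coin_adversary \<theta>" T
      by (rule interaction_coin[OF prior_le(2)[OF \<theta>]])
    interpret T: prob_space "coin_law \<theta> t" by (rule I.prob_space_joint_law[OF t])
    let ?\<phi> = "\<lambda>h. 2 * l * prior_weight r \<theta> - l\<^sup>2 * (weighted_score r \<theta> t h)\<^sup>2"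
    have gm: "(\<lambda>h. (weighted_score r \<theta> t h)\<^sup>2) \<in> borel_measurable (hist t)"
      unfolding weighted_score_def
      by (intro borel_measurable_power borel_measurable_add borel_measurable_times
          borel_measurable_const centred_sum_measurable)
    have gi: "integrable (coin_law \<theta> t) (\<lambda>h. (weighted_score r \<theta> t h)\<^sup>2)"
      by (rule I.integrable_joint_law[OF t gm]) (use gb[OF \<theta>] in auto)
    have "(\<integral>h. K \<theta> h \<partial>?P) = (\<integral>h. ?\<phi> h \<partial>coin_law \<theta> t)"
      unfolding K_def
      by (rule change_of_measure[OF prior_le(2)[OF \<theta>] t _ \<phi>b[OF \<theta>], symmetric])
        (intro borel_measurable_diff borel_measurable_times borel_measurable_const gm)
    also have "\<dots> = 2 * l * prior_weight r \<theta> - l\<^sup>2 * (\<integral>h. (weighted_score r \<theta> t h)\<^sup>2 \<partial>coin_law \<theta> t)"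
      using gi T.prob_space by simp
    also have "(\<integral>h. (weighted_score r \<theta> t h)\<^sup>2 \<partial>coin_law \<theta> t)
        = (prior_weight_deriv r \<theta>)\<^sup>2 + (r\<^sup>2 - \<theta>\<^sup>2)\<^sup>2 * ?n * (1 - \<theta>\<^sup>2)"
      unfolding weighted_score_def
      by (rule integral_affine_centred_sum_sq[OF prior_le(2)[OF \<theta>] t])
    finally show ?thesis
      using mult_left_mono[OF information_bound[OF r prior_le(1)[OF \<theta>] n], of "l\<^sup>2"] by simp
  qed

  have wi: "integrable (prior r) (prior_weight r)"
    unfolding prior_weight_def by (intro integrable_prior continuous_intros)
  have lr: "l * r\<^sup>2 = 1 / (4 * ?n)"
    using r by (simp add: l_def)
  have "2 * l * r ^ 3 - l\<^sup>2 * (2 * ?n * r ^ 4) * (2 * r) = 2 * r * (l * r\<^sup>2) - 4 * ?n * r * (l * r\<^sup>2)\<^sup>2"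
    by (simp add: power2_eq_square power3_eq_cube power4_eq_xxxx)
  also have "\<dots> = r / (4 * ?n)"
    using n0 unfolding lr by (simp only: power2_eq_square) (simp add: divide_simps del: of_nat_diff)
  finally have "r / (4 * ?n) = 2 * l * r ^ 3 - l\<^sup>2 * (2 * ?n * r ^ 4) * (2 * r)" ..
  also have "\<dots> \<le> 2 * l * (\<integral>\<theta>. prior_weight r \<theta> \<partial>prior r) - l\<^sup>2 * (2 * ?n * r ^ 4) * (2 * r)"
  proof -
    have "0 \<le> 2 * l" using n0 r by (simp add: l_def)
    from mult_left_mono[OF integral_prior_weight this, of r] r show ?thesis by simp
  qed
  also have "\<dots> = (\<integral>\<theta>. 2 * l * prior_weight r \<theta> - l\<^sup>2 * (2 * ?n * r ^ 4) \<partial>prior r)"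
  proof -
    have "measure (prior r) (space (prior r)) = 2 * r"
      using r by (simp add: measure_restrict_space)
    then show ?thesis using wi by simp
  qed
  also have "\<dots> \<le> (\<integral>\<theta>. (\<integral>h. K \<theta> h \<partial>?P) \<partial>prior r)"
  proof (rule integral_mono)
    show "integrable (prior r) (\<lambda>\<theta>. 2 * l * prior_weight r \<theta> - l\<^sup>2 * (2 * ?n * r ^ 4))"
      using wi by simp
  qed (rule integrable_fst[OF Ki], rule EK)
  \<comment> \<open>The comparison of K and F holds for a fixed history after integration over
    \<theta>, so the order of integration is exchanged before it and restored after it.\<close>
  also have "\<dots> = (\<integral>h. (\<integral>\<theta>. K \<theta> h \<partial>prior r) \<partial>?P)"
    by (rule Fubini_integral[OF Ki, symmetric])
  also have "\<dots> \<le> (\<integral>h. (\<integral>\<theta>. F \<theta> h \<partial>prior r) \<partial>?P)"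
  proof (rule integral_mono)
    fix h assume "h \<in> space ?P"
    then show "(\<integral>\<theta>. K \<theta> h \<partial>prior r) \<le> (\<integral>\<theta>. F \<theta> h \<partial>prior r)"
      unfolding F_def K_def spP by (rule integral_prior_completed_square[OF _ r])
  qed (rule integrable_snd[OF Ki], rule integrable_snd[OF Fi])
  also have "\<dots> = (\<integral>\<theta>. (\<integral>h. F \<theta> h \<partial>?P) \<partial>prior r)"
    by (rule Fubini_integral[OF Fi])
  also have "\<dots> = (\<integral>\<theta>. (\<integral>h. (y h - \<theta>)\<^sup>2 \<partial>coin_law \<theta> t) \<partial>prior r)"
    by (rule Bochner_Integration.integral_cong[OF refl]) (rule EF[symmetric])
  finally show "r / (4 * ?n) \<le> (\<integral>\<theta>. (\<integral>h. (y h - \<theta>)\<^sup>2 \<partial>coin_law \<theta> t) \<partial>prior r)" .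
qed

end

section \<open>Quadratic losses\<close>

lemma norm_Rn_sq: "(norm_Rn d x)\<^sup>2 = inner_Rn d x x"
  by (simp add: norm_Rn_def inner_Rn_def L2_set_def sum_nonneg power2_eq_square)

lemma norm_Rn_nonneg: "0 \<le> norm_Rn d x"
  by (simp add: norm_Rn_def)

lemma norm_Rn_scaleR: "norm_Rn d (c *\<^sub>R x) = \<bar>c\<bar> * norm_Rn d x"
  by (simp add: norm_Rn_def L2_set_def scaleR_fun_def power_mult_distrib
      sum_distrib_left[symmetric] real_sqrt_mult)

lemma norm_Rn_diff_triangle: "norm_Rn d (x - y) \<le> norm_Rn d x + norm_Rn d y"
proof -
  have "norm_Rn d (x - y) \<le> norm_Rn d x + L2_set (\<lambda>i. - y i) {..<d}"
    using L2_set_triangle_ineq[of x "\<lambda>i. - y i" "{..<d}"] by (simp add: norm_Rn_def fun_diff_def)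
  then show ?thesis by (simp add: norm_Rn_def L2_set_def)
qed

lemma inner_Rn_Cauchy_Schwarz: "\<bar>inner_Rn d x y\<bar> \<le> norm_Rn d x * norm_Rn d y"
proof -
  have "\<bar>inner_Rn d x y\<bar> \<le> (\<Sum>i<d. \<bar>x i\<bar> * \<bar>y i\<bar>)"
    unfolding inner_Rn_def by (intro order_trans[OF sum_abs]) (simp add: abs_mult)
  also have "\<dots> \<le> norm_Rn d x * norm_Rn d y"
    unfolding norm_Rn_def by (rule L2_set_mult_ineq)
  finally show ?thesis .
qed

lemma Rn_closed:
  "x \<in> Rn d \<Longrightarrow> y \<in> Rn d \<Longrightarrow> x - y \<in> Rn d" "x \<in> Rn d \<Longrightarrow> c *\<^sub>R x \<in> Rn d"
  "x \<in> Rn d \<Longrightarrow> y \<in> Rn d \<Longrightarrow> x + y \<in> Rn d"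
  by (simp_all add: topspace_Euclidean_space scaleR_fun_def)

lemma norm_Rn_eq_0: "x \<in> Rn d \<Longrightarrow> norm_Rn d x = 0 \<longleftrightarrow> x = 0"
  by (auto simp: norm_Rn_def L2_set_eq_0_iff topspace_Euclidean_space fun_eq_iff) (metis lessThan_iff not_less)

lemma coordinate_borel_measurable: "(\<lambda>x :: real_seq. x i) \<in> borel_measurable borel"
  by (intro borel_measurable_continuous_onI continuous_on_product_coordinates)

lemma inner_Rn_borel_measurable: "(\<lambda>x. inner_Rn d v (x - p)) \<in> borel_measurable (actions X)"
  unfolding inner_Rn_def fun_diff_def
  by (intro measurable_restrict_space1 borel_measurable_sum borel_measurable_times
      borel_measurable_diff borel_measurable_const coordinate_borel_measurable)

lemma norm_Rn_borel_measurable: "(\<lambda>x. norm_Rn d (x - p)) \<in> borel_measurable (actions X)"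
  unfolding norm_Rn_def L2_set_def fun_diff_def
  by (intro measurable_restrict_space1 measurable_compose[OF _ borel_measurable_sqrt]
      borel_measurable_sum borel_measurable_power
      borel_measurable_diff borel_measurable_const coordinate_borel_measurable)

lemma norm_Rn_diff_tendsto: "((\<lambda>y. norm_Rn d (y - x)) \<longlongrightarrow> 0) (at x within S)"
proof -
  have "((\<lambda>y. y i) \<longlongrightarrow> x i) (at x within S)" for i
    using continuous_on_product_coordinates[of i]
    by (auto simp: continuous_on_def intro: tendsto_within_subset)
  then have "((\<lambda>y. sqrt (\<Sum>i<d. (y i - x i)\<^sup>2)) \<longlongrightarrow> sqrt (\<Sum>i<d. (x i - x i)\<^sup>2)) (at x within S)"
    by (intro tendsto_intros)
  then show ?thesis by (simp add: norm_Rn_def L2_set_def)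
qed

section \<open>The quadratic loss and its moments under a coin\<close>

definition quadratic_loss ::
    "nat \<Rightarrow> real \<Rightarrow> real \<Rightarrow> real_seq \<Rightarrow> real_seq \<Rightarrow> real_seq \<Rightarrow> real \<Rightarrow> real"
  where "quadratic_loss d \<mu> s p v x \<xi>
    = \<mu> / 2 * (norm_Rn d (x - p))\<^sup>2 - s * \<xi> * inner_Rn d v (x - p)"

text \<open>The Hessian is \<mu> times the identity, so the second-order expansion has no
  remainder.\<close>

lemma quadratic_loss_expansion:
  "quadratic_loss d \<mu> s p v y \<xi> - quadratic_loss d \<mu> s p v x \<xi>
    - inner_Rn d (\<mu> *\<^sub>R (x - p) - (s * \<xi>) *\<^sub>R v) (y - x) = \<mu> / 2 * (norm_Rn d (y - x))\<^sup>2"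
  unfolding quadratic_loss_def norm_Rn_sq inner_Rn_def scaleR_fun_def sum_distrib_left
    sum_subtractf[symmetric]
  by (intro sum.cong) (auto simp: algebra_simps)

text \<open>An equality for every sample value: it yields convexity of each sampled loss and
  \<mu>-strong convexity of the mean loss at once.\<close>

lemma quadratic_loss_convex_combination:
  "quadratic_loss d \<mu> s p v (c *\<^sub>R x + (1 - c) *\<^sub>R y) \<xi>
    = c * quadratic_loss d \<mu> s p v x \<xi> + (1 - c) * quadratic_loss d \<mu> s p v y \<xi>
      - \<mu> / 2 * c * (1 - c) * (norm_Rn d (x - y))\<^sup>2"
  unfolding quadratic_loss_def norm_Rn_sq inner_Rn_def scaleR_fun_def sum_distrib_left
    sum_subtractf[symmetric] sum.distrib[symmetric]
  by (intro sum.cong) (auto simp: field_simps)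

lemma quadratic_loss_has_gradient:
  assumes "x \<in> Rn d" "p \<in> Rn d" "v \<in> Rn d"
  shows "has_gradient d (\<lambda>y. quadratic_loss d \<mu> s p v y \<xi>) x (\<mu> *\<^sub>R (x - p) - (s * \<xi>) *\<^sub>R v)"
proof -
  have "((\<lambda>y. \<mu> / 2 * norm_Rn d (y - x)) \<longlongrightarrow> \<mu> / 2 * 0) (at x within Rn d)"
    by (intro tendsto_intros norm_Rn_diff_tendsto)
  \<comment> \<open>For n = 0 division by zero gives 0, which agrees with the right-hand
    side.\<close>
  moreover have "\<mu> / 2 * n\<^sup>2 / n = \<mu> / 2 * n" for n :: real
    by (cases "n = 0") (simp_all add: power2_eq_square)
  ultimately show ?thesis
    using assms by (simp only: has_gradient_def quadratic_loss_expansion) (simp add: Rn_closed)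
qed

lemma quadratic_loss_gradient:
  assumes "x \<in> Rn d" "p \<in> Rn d" "v \<in> Rn d"
  shows "gradient d (\<lambda>y. quadratic_loss d \<mu> s p v y \<xi>) x = \<mu> *\<^sub>R (x - p) - (s * \<xi>) *\<^sub>R v"
  unfolding gradient_def
  using quadratic_loss_has_gradient[OF assms] has_gradient_unique[OF assms(1)] by blast

lemma quadratic_loss_measurable:
  "(\<lambda>(x, \<xi>). quadratic_loss d \<mu> s p v x \<xi>) \<in> borel_measurable (actions X \<Otimes>\<^sub>M signs)"
proof -
  have "snd \<in> borel_measurable (actions X \<Otimes>\<^sub>M signs)"
    by (rule measurable_compose[OF measurable_snd, of "\<lambda>\<xi>. \<xi>", simplified]) simp
  then show ?thesis
    unfolding quadratic_loss_def case_prod_beta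
    by (intro borel_measurable_diff borel_measurable_times borel_measurable_const
        borel_measurable_power measurable_compose[OF measurable_fst norm_Rn_borel_measurable]
        measurable_compose[OF measurable_fst inner_Rn_borel_measurable])
qed

lemma quadratic_loss_function:
  assumes "X \<subseteq> Rn d" "p \<in> Rn d" "v \<in> Rn d"
  shows "loss_function d X signs (quadratic_loss d \<mu> s p v)"
  unfolding loss_function_def
proof (intro conjI ballI allI impI)
  show "\<exists>g. has_gradient d (\<lambda>y. quadratic_loss d \<mu> s p v y \<xi>) x g" if "x \<in> X" for x \<xi>
    using quadratic_loss_has_gradient[OF _ assms(2,3)] that assms(1) by blast
qed (rule quadratic_loss_measurable, simp)

text \<open>The loss is affine in the sample, so averaging replaces the sample by its mean.\<close>

lemma quadratic_mean_loss:
  assumes "\<bar>\<theta>\<bar> \<le> 1"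
  shows "mean_loss (quadratic_loss d \<mu> s p v) (coin \<theta>) x = quadratic_loss d \<mu> s p v x \<theta>"
  unfolding mean_loss_def integral_coin[OF assms] quadratic_loss_def by (simp add: field_simps)

lemma quadratic_mean_gradient:
  assumes "x \<in> Rn d" "p \<in> Rn d" "v \<in> Rn d" and "\<bar>\<theta>\<bar> \<le> 1"
  shows "mean_gradient d (quadratic_loss d \<mu> s p v) (coin \<theta>) x = \<mu> *\<^sub>R (x - p) - (s * \<theta>) *\<^sub>R v"
proof
  fix i
  show "mean_gradient d (quadratic_loss d \<mu> s p v) (coin \<theta>) x i = (\<mu> *\<^sub>R (x - p) - (s * \<theta>) *\<^sub>R v) i"
    using assms unfolding mean_gradient_def quadratic_loss_gradient[OF assms(1-3)] integral_coin[OF assms(4)]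
    by (auto simp: scaleR_fun_def topspace_Euclidean_space field_simps)
qed

lemma quadratic_deviation_sq:
  assumes "x \<in> Rn d" "p \<in> Rn d" "v \<in> Rn d" "norm_Rn d v = 1" and "\<bar>\<theta>\<bar> \<le> 1"
  shows "deviation_sq d (quadratic_loss d \<mu> s p v) (coin \<theta>) x \<xi> = s\<^sup>2 * (\<xi> - \<theta>)\<^sup>2"
proof -
  have "\<mu> *\<^sub>R (x - p) - (s * \<xi>) *\<^sub>R v - (\<mu> *\<^sub>R (x - p) - (s * \<theta>) *\<^sub>R v) = (s * (\<theta> - \<xi>)) *\<^sub>R v"
    by (simp add: algebra_simps)
  then show ?thesis
    unfolding deviation_sq_def quadratic_loss_gradient[OF assms(1-3)]
      quadratic_mean_gradient[OF assms(1-3,5)]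
    by (simp add: norm_Rn_scaleR assms(4) power_mult_distrib power2_commute)
qed

text \<open>The random part of the gradient is the same multiple of v at every x, so the supremum
  runs over a constant: the square of s times the variance of the coin.\<close>

lemma quadratic_variance_sq:
  assumes "X \<subseteq> Rn d" "X \<noteq> {}" "p \<in> Rn d" "v \<in> Rn d" "norm_Rn d v = 1" and \<theta>: "\<bar>\<theta>\<bar> \<le> 1"
  shows "variance_sq d X (quadratic_loss d \<mu> s p v) (coin \<theta>) = s\<^sup>2 * (1 - \<theta>\<^sup>2)"
proof -
  have "(\<integral>\<xi>. deviation_sq d (quadratic_loss d \<mu> s p v) (coin \<theta>) x \<xi> \<partial>coin \<theta>) = s\<^sup>2 * (1 - \<theta>\<^sup>2)"
    if "x \<in> X" for x
  proof -
    have "x \<in> Rn d" using that assms by auto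
    then show ?thesis
      unfolding integral_coin[OF \<theta>] quadratic_deviation_sq[OF _ assms(3-5) \<theta>]
      by (subst (1 2) quadratic_deviation_sq[OF _ assms(3-5) \<theta>]) (auto simp: field_simps power2_eq_square)
  qed
  then show ?thesis
    unfolding variance_sq_def using assms(2) by simp
qed

lemma quadratic_shift_sq:
  assumes "X \<subseteq> Rn d" "X \<noteq> {}" "p \<in> Rn d" "v \<in> Rn d" "norm_Rn d v = 1"
    and "\<bar>\<theta>\<bar> \<le> 1" "\<bar>\<eta>\<bar> \<le> 1"
  shows "shift_sq d X (quadratic_loss d \<mu> s p v) (coin \<theta>) (coin \<eta>) = s\<^sup>2 * (\<theta> - \<eta>)\<^sup>2"
proof -
  let ?f = "quadratic_loss d \<mu> s p v"
  have "(norm_Rn d (mean_gradient d ?f (coin \<theta>) x - mean_gradient d ?f (coin \<eta>) x))\<^sup>2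
      = s\<^sup>2 * (\<theta> - \<eta>)\<^sup>2" if "x \<in> X" for x
  proof -
    have x: "x \<in> Rn d" using that assms by auto
    have "\<mu> *\<^sub>R (x - p) - (s * \<theta>) *\<^sub>R v - (\<mu> *\<^sub>R (x - p) - (s * \<eta>) *\<^sub>R v) = (s * (\<eta> - \<theta>)) *\<^sub>R v"
      by (simp add: algebra_simps)
    then show ?thesis
      unfolding quadratic_mean_gradient[OF x assms(3,4,6)] quadratic_mean_gradient[OF x assms(3,4,7)]
      by (simp add: norm_Rn_scaleR assms(5) power_mult_distrib power2_commute)
  qed
  then show ?thesis
    unfolding shift_sq_def using assms(2) by simp
qed

text \<open>\<mu> serves both as Lipschitz constant and as modulus of strong convexity, because the
  mean gradient is affine with slope \<mu>.\<close>

lemma quadratic_distribution_assumptions: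
  assumes X: "X \<subseteq> Rn d" "convex X" and p: "p \<in> Rn d" and v: "v \<in> Rn d" "norm_Rn d v = 1"
    and R: "\<And>x. x \<in> X \<Longrightarrow> norm_Rn d (x - p) \<le> R"
    and "0 < \<mu>" "0 \<le> s" and \<theta>: "\<bar>\<theta>\<bar> \<le> 1"
  shows "distribution_assumptions d X (quadratic_loss d \<mu> s p v) (\<mu> * R + s) \<mu> \<mu> (coin \<theta>)"
proof -
  let ?f = "quadratic_loss d \<mu> s p v"
  note grad = quadratic_loss_gradient[OF _ p v(1)] and mgrad = quadratic_mean_gradient[OF _ p v(1) \<theta>]
  have sc: "strongly_convex_on d \<mu> X (\<lambda>x. ?f x \<xi>)" for \<xi>
    using X(2) unfolding strongly_convex_on_def quadratic_loss_convex_combination by simp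
  have "convex_on X (\<lambda>x. ?f x \<xi>)" for \<xi>
    unfolding convex_on_alt
  proof (intro conjI ballI allI impI X(2))
    fix x y and c :: real assume "0 \<le> c \<and> c \<le> 1"
    then have "0 \<le> \<mu> / 2 * c * (1 - c) * (norm_Rn d (x - y))\<^sup>2"
      using \<open>0 < \<mu>\<close> by simp
    then show "?f (c *\<^sub>R x + (1 - c) *\<^sub>R y) \<xi> \<le> c * ?f x \<xi> + (1 - c) * ?f y \<xi>"
      unfolding quadratic_loss_convex_combination by simp
  qed
  moreover have "norm_Rn d (gradient d (\<lambda>y. ?f y \<xi>) x) \<le> \<mu> * R + s"
    if "x \<in> X" "\<xi> = 1 \<or> \<xi> = - 1" for x \<xi>
  proof -
    have "norm_Rn d (\<mu> *\<^sub>R (x - p) - (s * \<xi>) *\<^sub>R v) \<le> \<mu> * norm_Rn d (x - p) + s"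
      using norm_Rn_diff_triangle[of d "\<mu> *\<^sub>R (x - p)" "(s * \<xi>) *\<^sub>R v"] that(2) assms
      by (auto simp: norm_Rn_scaleR)
    also have "\<dots> \<le> \<mu> * R + s"
      using R[OF that(1)] \<open>0 < \<mu>\<close> by simp
    finally show ?thesis using that(1) X(1) by (subst grad) auto
  qed
  ultimately have "AE \<xi> in coin \<theta>. convex_on X (\<lambda>x. ?f x \<xi>)
      \<and> (\<forall>x\<in>X. norm_Rn d (gradient d (\<lambda>y. ?f y \<xi>) x) \<le> \<mu> * R + s)"
    by (intro AE_I2) auto
  moreover have "norm_Rn d (mean_gradient d ?f (coin \<theta>) x - mean_gradient d ?f (coin \<theta>) y)
      \<le> \<mu> * norm_Rn d (x - y)" if "x \<in> X" "y \<in> X" for x y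
  proof -
    have "mean_gradient d ?f (coin \<theta>) x - mean_gradient d ?f (coin \<theta>) y = \<mu> *\<^sub>R (x - y)"
      using mgrad[OF subsetD[OF X(1) that(1)]] mgrad[OF subsetD[OF X(1) that(2)]]
      by (simp add: scaleR_diff_right)
    then show ?thesis using \<open>0 < \<mu>\<close> by (simp add: norm_Rn_scaleR)
  qed
  moreover have "strongly_convex_on d \<mu> X (mean_loss ?f (coin \<theta>))"
    using sc[of \<theta>] quadratic_mean_loss[OF \<theta>] unfolding strongly_convex_on_def by simp
  ultimately show ?thesis
    unfolding distribution_assumptions_def by simp
qed

text \<open>By Cauchy-Schwarz, dropping the component of x - p orthogonal to v can only lower the
  loss; the rest is a quadratic in one variable, expanded around c. For c = s \<theta> / \<mu> the
  coefficient of the linear term is s (\<xi> - \<theta>), of mean 0 under bias \<theta>.\<close>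

lemma quadratic_loss_excess:
  fixes p x :: real_seq
  assumes "0 < \<mu>" and v: "norm_Rn d v = 1"
  defines "z \<equiv> \<lambda>x. inner_Rn d v (x - p)"
  shows "\<mu> / 2 * (z x - c)\<^sup>2 - (s * \<xi> - \<mu> * c) * (z x - c)
    \<le> quadratic_loss d \<mu> s p v x \<xi> - quadratic_loss d \<mu> s p v (p + c *\<^sub>R v) \<xi>"
proof -
  have "inner_Rn d v v = 1" using norm_Rn_sq[of d v] v by simp
  then have "inner_Rn d v (c *\<^sub>R v) = c"
    by (simp add: inner_Rn_def scaleR_fun_def sum_distrib_left[symmetric] mult.left_commute)
  then have u: "quadratic_loss d \<mu> s p v (p + c *\<^sub>R v) \<xi> = \<mu> / 2 * c\<^sup>2 - s * \<xi> * c"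
    by (simp add: quadratic_loss_def norm_Rn_scaleR v)
  have "\<bar>z x\<bar> \<le> norm_Rn d (x - p)"
    using inner_Rn_Cauchy_Schwarz[of d v "x - p"] v by (simp add: z_def)
  then have "(z x)\<^sup>2 \<le> (norm_Rn d (x - p))\<^sup>2"
    by (metis abs_ge_zero power2_abs power_mono)
  then have "\<mu> / 2 * (z x)\<^sup>2 - s * \<xi> * z x \<le> quadratic_loss d \<mu> s p v x \<xi>"
    using \<open>0 < \<mu>\<close> by (simp add: quadratic_loss_def z_def)
  with u show ?thesis
    by (simp add: power2_eq_square algebra_simps)
qed

lemma quadratic_loss_bound:
  assumes "norm_Rn d (x - p) \<le> R" "0 < \<mu>" "0 \<le> s" "norm_Rn d v = 1" "\<bar>\<xi>\<bar> \<le> 1"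
  shows "\<bar>quadratic_loss d \<mu> s p v x \<xi>\<bar> \<le> \<mu> / 2 * R\<^sup>2 + s * R"
proof -
  have "\<bar>inner_Rn d v (x - p)\<bar> \<le> R"
    using inner_Rn_Cauchy_Schwarz[of d v "x - p"] assms by simp
  moreover have "\<bar>s * \<xi>\<bar> \<le> s"
    using assms mult_left_mono[of "\<bar>\<xi>\<bar>" 1 s] by (simp add: abs_mult)
  ultimately have "\<bar>s * \<xi> * inner_Rn d v (x - p)\<bar> \<le> s * R"
    using assms by (subst abs_mult) (intro mult_mono, auto)
  moreover have "\<bar>\<mu> / 2 * (norm_Rn d (x - p))\<^sup>2\<bar> \<le> \<mu> / 2 * R\<^sup>2"
    using assms norm_Rn_nonneg[of d "x - p"] by (simp add: abs_mult power_mono)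
  ultimately show ?thesis
    unfolding quadratic_loss_def by linarith
qed

text \<open>The midpoint is taken as p so that the segment extends equally to both sides; the bias,
  and with it the displacement of the comparator, can have either sign.\<close>

lemma exists_segment:
  assumes X: "X \<subseteq> Rn d" "convex X" and diam: "0 < diameter_Rn d X"
  obtains p v l where "p \<in> Rn d" "v \<in> Rn d" "norm_Rn d v = 1" "0 < l"
    "\<And>c. \<bar>c\<bar> \<le> l \<Longrightarrow> p + c *\<^sub>R v \<in> X"
proof -
  have "\<exists>a\<in>X. \<exists>b\<in>X. a \<noteq> b"
  proof (rule ccontr)
    assume "\<not> (\<exists>a\<in>X. \<exists>b\<in>X. a \<noteq> b)"
    then have "(SUP (x, y)\<in>X \<times> X. norm_Rn d (x - y)) = (SUP (x, y)\<in>X \<times> X. norm_Rn d 0)"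
      by (intro SUP_cong) auto
    then have "diameter_Rn d X = (if X = {} then 0 else (SUP (x, y)\<in>X \<times> X. norm_Rn d 0))"
      by (simp add: diameter_Rn_def)
    also have "\<dots> = 0"
      by (auto simp: norm_Rn_def L2_set_def case_prod_beta)
    finally show False using diam by simp
  qed
  then obtain a b where ab: "a \<in> X" "b \<in> X" "a \<noteq> b" by auto
  define n where "n = norm_Rn d (b - a)"
  have "b - a \<in> Rn d" using ab X by (auto intro: Rn_closed)
  with ab have n: "0 < n"
    using norm_Rn_eq_0[of "b - a" d] norm_Rn_nonneg[of d "b - a"] by (auto simp: n_def)
  define p where "p = (1 / 2) *\<^sub>R a + (1 / 2) *\<^sub>R b"
  define v where "v = (1 / n) *\<^sub>R (b - a)"
  show ?thesis
  proof
    show "p \<in> Rn d" "v \<in> Rn d"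
      using ab X by (auto simp: p_def v_def intro!: Rn_closed)
    show "norm_Rn d v = 1" using n by (simp add: v_def norm_Rn_scaleR n_def[symmetric])
    show "0 < n / 2" using n by simp
    fix c assume c: "\<bar>c\<bar> \<le> n / 2"
    have "p + c *\<^sub>R v = (1 / 2 - c / n) *\<^sub>R a + (1 / 2 + c / n) *\<^sub>R b"
      by (simp add: p_def v_def algebra_simps)
    also have "\<dots> \<in> X"
      using c n ab by (intro convexD[OF X(2)]) (auto simp: field_simps abs_le_iff)
    finally show "p + c *\<^sub>R v \<in> X" .
  qed
qed

section \<open>Regret against coin-flipping adversaries\<close>

lemma ln_diff_le_sum_inverse:
  assumes "1 \<le> N" "N \<le> n"
  shows "ln (real n) - ln (real N) \<le> (\<Sum>t\<in>{N..<n}. 1 / real t)"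
  using assms(2)
proof (induction n rule: dec_induct)
  case (step n)
  then have "ln (real (Suc n)) - ln (real n) \<le> 1 / real n"
    using assms(1) ln_diff_le[of "real (Suc n)" "real n"] by simp
  with step show ?case by simp
qed simp

lemma scaled_inner_Rn_bound:
  assumes "norm_Rn d v = 1" "norm_Rn d w \<le> R" "0 \<le> c"
  shows "\<bar>c * inner_Rn d v w\<bar> \<le> c * R"
proof -
  have "\<bar>inner_Rn d v w\<bar> \<le> R"
    using inner_Rn_Cauchy_Schwarz[of d v w] assms(1,2) by simp
  then show ?thesis
    using assms(3) by (simp add: abs_mult mult_left_mono)
qed

context coin_game
begin

text \<open>Averaging: the prior has mass 2 r and round t contributes at least r / (4 t), so the
  mean over \<theta> of the summed risk is at least 1/8 of the harmonic sum. Claiming only 1/16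
  leaves room for a strict contradiction.\<close>

lemma exists_hard_bias:
  fixes y :: "real_seq \<Rightarrow> real"
  assumes r: "0 < r" "r \<le> 1 / 2" and N: "1 \<le> N" "7 \<le> real N * r\<^sup>2" "N \<le> T"
    and m: "y \<in> borel_measurable (actions X)" and b: "\<And>x. x \<in> X \<Longrightarrow> \<bar>y x\<bar> \<le> B"
  shows "\<exists>\<theta>. \<bar>\<theta>\<bar> \<le> r \<and> (ln (real T) - ln (real N)) / 16
    \<le> (\<Sum>t\<in>{N..<T}. \<integral>h. (y (fst (h t)) - \<theta>)\<^sup>2 \<partial>coin_law \<theta> (Suc t))"
proof (rule ccontr)
  let ?\<rho> = "\<lambda>t \<theta>. \<integral>h. (y (fst (h t)) - \<theta>)\<^sup>2 \<partial>coin_law \<theta> (Suc t)"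
  define k where "k = (ln (real T) - ln (real N)) / 16"
  assume "\<not> (\<exists>\<theta>. \<bar>\<theta>\<bar> \<le> r \<and> (ln (real T) - ln (real N)) / 16 \<le> (\<Sum>t\<in>{N..<T}. ?\<rho> t \<theta>))"
  then have less: "(\<Sum>t\<in>{N..<T}. ?\<rho> t \<theta>) < k" if "\<bar>\<theta>\<bar> \<le> r" for \<theta>
    using that by (force simp: k_def)
  \<comment> \<open>The negated claim at bias 0 forces k to be positive, without which the final
    inequality would be no contradiction.\<close>
  have "0 \<le> (\<Sum>t\<in>{N..<T}. ?\<rho> t 0)"
    by (intro sum_nonneg Bochner_Integration.integral_nonneg) simp
  also have "\<dots> < k" using r by (intro less) simp
  finally have k: "0 < k" .
  have bound: "integrable (prior r) (?\<rho> t)" "r / (4 * real t) \<le> integral\<^sup>L (prior r) (?\<rho> t)"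
    if t: "t \<in> {N..<T}" for t
  proof -
    have "Suc t \<le> T" using t by simp
    \<comment> \<open>The history of length Suc t contains the action of round t and also its
      sample. Allowing the estimate this extra sample gives exactly t informative ones.\<close>
    moreover have "7 \<le> real (Suc t - 1) * r\<^sup>2"
      using t N(2) mult_right_mono[of "real N" "real t" "r\<^sup>2"] by simp
    moreover have "(\<lambda>h. h t) \<in> hist (Suc t) \<rightarrow>\<^sub>M actions X \<Otimes>\<^sub>M signs"
      by (intro measurable_component_singleton) auto
    then have "(\<lambda>h. y (fst (h t))) \<in> borel_measurable (hist (Suc t))"
      by (rule measurable_compose[OF _ measurable_compose[OF measurable_fst m]])
    moreover have "\<bar>y (fst (h t))\<bar> \<le> B" if "h \<in> space (hist (Suc t))" for h
      using action_in_domain[OF that] by (intro b) simp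
    ultimately show "integrable (prior r) (?\<rho> t)" "r / (4 * real t) \<le> integral\<^sup>L (prior r) (?\<rho> t)"
      using van_trees_uniform_prior[OF _ r, of "Suc t" "\<lambda>h. y (fst (h t))" B] by auto
  qed
  have "4 * r * k \<le> r / 4 * (\<Sum>t\<in>{N..<T}. 1 / real t)"
    using mult_left_mono[OF ln_diff_le_sum_inverse[OF N(1,3)], of "r / 4"] r by (simp add: k_def)
  also have "\<dots> = (\<Sum>t\<in>{N..<T}. r / (4 * real t))"
    by (simp add: sum_distrib_left)
  also have "\<dots> \<le> (\<Sum>t\<in>{N..<T}. integral\<^sup>L (prior r) (?\<rho> t))"
    by (intro sum_mono bound)
  also have "\<dots> = (\<integral>\<theta>. (\<Sum>t\<in>{N..<T}. ?\<rho> t \<theta>) \<partial>prior r)"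
    by (rule Bochner_Integration.integral_sum[symmetric]) (rule bound(1))
  also have "\<dots> \<le> (\<integral>\<theta>. k \<partial>prior r)"
  proof (rule integral_mono)
    show "integrable (prior r) (\<lambda>\<theta>. \<Sum>t\<in>{N..<T}. ?\<rho> t \<theta>)"
      by (rule Bochner_Integration.integrable_sum) (rule bound(1))
    show "integrable (prior r) (\<lambda>\<theta>. k)"
      by (intro integrable_prior continuous_intros)
    show "(\<Sum>t\<in>{N..<T}. ?\<rho> t \<theta>) \<le> k" if "\<theta> \<in> space (prior r)" for \<theta>
      using that by (intro less_imp_le[OF less]) auto
  qed
  also have "\<dots> = 2 * r * k"
    using r by (simp add: measure_restrict_space)
  finally show False using r k by simp
qed

text \<open>The mean loss is minimal where the coordinate along v equals s \<theta> / \<mu>, so y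
  turns an action into the estimate of \<theta> that it represents; excess loss is then at least a
  multiple of squared estimation error.\<close>

lemma regret_lower_bound:
  fixes p v :: real_seq and \<mu> s \<theta> :: real
  assumes R: "\<And>x. x \<in> X \<Longrightarrow> norm_Rn d (x - p) \<le> R" and v: "norm_Rn d v = 1"
    and pos: "0 < \<mu>" "0 < s" and \<theta>: "\<bar>\<theta>\<bar> \<le> 1"
    and N: "1 \<le> N" "N \<le> T"
  defines "f \<equiv> quadratic_loss d \<mu> s p v" and "u \<equiv> p + (s * \<theta> / \<mu>) *\<^sub>R v"
    and "y \<equiv> \<lambda>x. \<mu> / s * inner_Rn d v (x - p)"
  assumes u: "u \<in> X"
  shows "integrable (coin_law \<theta> T) (regret f T u)"
    and "s\<^sup>2 / (2 * \<mu>) * (\<Sum>t\<in>{N..<T}. \<integral>h. (y (fst (h t)) - \<theta>)\<^sup>2 \<partial>coin_law \<theta> (Suc t))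
      - (\<mu> * R\<^sup>2 + 2 * s * R) \<le> (\<integral>h. regret f T u h \<partial>coin_law \<theta> T)"
proof -
  interpret interaction X signs a "coin_adversary \<theta>" T
    by (rule interaction_coin[OF \<theta>])
  let ?C = "\<mu> * R\<^sup>2 + 2 * s * R"
  define e where "e = (\<lambda>z. f (fst z) (snd z) - f u (snd z))"
  have fm: "(\<lambda>z. f (fst z) (snd z)) \<in> borel_measurable (actions X \<Otimes>\<^sub>M signs)"
    using quadratic_loss_measurable by (simp add: f_def case_prod_beta')
  have "(\<lambda>z. f u (snd z)) \<in> borel_measurable (actions X \<Otimes>\<^sub>M signs)"
    by (rule measurable_compose[OF measurable_snd]) simp
  with fm have em: "e \<in> borel_measurable (actions X \<Otimes>\<^sub>M signs)"
    unfolding e_def by (rule borel_measurable_diff)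
  have fb: "\<bar>f x \<xi>\<bar> \<le> ?C / 2" if "x \<in> X" "\<bar>\<xi>\<bar> \<le> 1" for x \<xi>
    using quadratic_loss_bound[OF R[OF that(1)], of \<mu> s v \<xi>] pos v that(2) by (simp add: f_def add_divide_distrib)
  have eb: "\<bar>e z\<bar> \<le> ?C" if "z \<in> space (actions X \<Otimes>\<^sub>M signs)" for z
  proof -
    have "fst z \<in> X" "\<bar>snd z\<bar> \<le> 1"
      using that by (auto simp: space_pair_measure space_restrict_space)
    from add_mono[OF fb[OF this] fb[OF u this(2)]]
    have "\<bar>f (fst z) (snd z)\<bar> + \<bar>f u (snd z)\<bar> \<le> ?C"
      by (simp only: field_sum_of_halves)
    then show ?thesis
      unfolding e_def by (rule order_trans[OF abs_triangle_ineq4])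
  qed
  have cm: "(\<lambda>h. h t) \<in> hist n \<rightarrow>\<^sub>M actions X \<Otimes>\<^sub>M signs" if "t < n" for t n
    using that by (intro measurable_component_singleton) auto
  have in_space: "h t \<in> space (actions X \<Otimes>\<^sub>M signs)" if "h \<in> space (hist n)" "t < n" for h t n
    using measurable_space[OF cm[OF that(2)] that(1)] .
  have ei: "integrable (coin_law \<theta> n) (\<lambda>h. e (h t))" if "t < n" "n \<le> T" for t n
    by (rule integrable_joint_law[OF that(2) measurable_compose[OF cm[OF that(1)] em]])
      (rule eb[OF in_space[OF _ that(1)]])
  have regret: "regret f T u = (\<lambda>h. \<Sum>t<T. e (h t))"
    by (simp add: regret_def e_def fun_eq_iff)
  show "integrable (coin_law \<theta> T) (regret f T u)"
    unfolding regret by (intro Bochner_Integration.integrable_sum ei) auto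

  have ym: "y \<in> borel_measurable (actions X)"
    unfolding y_def by (intro borel_measurable_times borel_measurable_const inner_Rn_borel_measurable)
  have yb: "\<bar>y x\<bar> \<le> \<mu> / s * R" if "x \<in> X" for x
    unfolding y_def using pos by (intro scaled_inner_Rn_bound v R that) simp
  let ?\<rho> = "\<lambda>t. \<integral>h. (y (fst (h t)) - \<theta>)\<^sup>2 \<partial>coin_law \<theta> (Suc t)"
  \<comment> \<open>In round 0 the bias is 1 while u is the minimizer for \<theta>, so the excess
    may be negative; it is bounded by twice the largest loss on X.\<close>
  have first: "- ?C \<le> (\<integral>h. e (h 0) \<partial>coin_law \<theta> (Suc 0))"
  proof -
    have T: "Suc 0 \<le> T" using N by simp
    interpret P: prob_space "coin_law \<theta> (Suc 0)" by (rule prob_space_joint_law[OF T])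
    have "- ?C = (\<integral>h. - ?C \<partial>coin_law \<theta> (Suc 0))" using P.prob_space by (simp del: joint_law.simps)
    also have "\<dots> \<le> (\<integral>h. e (h 0) \<partial>coin_law \<theta> (Suc 0))"
    proof (rule integral_mono)
      show "integrable (coin_law \<theta> (Suc 0)) (\<lambda>h. e (h 0))" using T by (intro ei) auto
      fix h assume "h \<in> space (coin_law \<theta> (Suc 0))"
      then show "- ?C \<le> e (h 0)"
        using eb[OF in_space[of h "Suc 0" 0]] space_joint_law[OF T] by (simp add: abs_le_iff)
    qed (rule P.integrable_const)
    finally show ?thesis .
  qed
  have later: "s\<^sup>2 / (2 * \<mu>) * ?\<rho> t \<le> (\<integral>h. e (h t) \<partial>coin_law \<theta> (Suc t))" if t: "0 < t" "t < T" for t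
  proof -
    have T: "Suc t \<le> T" using t by simp
    note ytm = measurable_compose[OF cm[OF lessI] measurable_compose[OF measurable_fst ym]]
    have yd: "\<bar>y x - \<theta>\<bar> \<le> \<mu> / s * R + 1" if "x \<in> X" for x
      using yb[OF that] \<theta> by linarith
    have i1: "integrable (coin_law \<theta> (Suc t)) (\<lambda>h. (y (fst (h t)) - \<theta>)\<^sup>2)"
    proof (rule integrable_joint_law[OF T])
      show "(\<lambda>h. (y (fst (h t)) - \<theta>)\<^sup>2) \<in> borel_measurable (hist (Suc t))"
        by (intro borel_measurable_power borel_measurable_diff borel_measurable_const ytm)
      fix h assume "h \<in> space (hist (Suc t))"
      from power_mono[OF yd[OF action_in_domain[OF this lessI]] abs_ge_zero, of 2]
      show "\<bar>(y (fst (h t)) - \<theta>)\<^sup>2\<bar> \<le> (\<mu> / s * R + 1)\<^sup>2"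
        by simp
    qed
    have i2: "integrable (coin_law \<theta> (Suc t)) (\<lambda>h. (snd (h t) - \<theta>) * (y (fst (h t)) - \<theta>))"
    proof (rule integrable_joint_law[OF T])
      show "(\<lambda>h. (snd (h t) - \<theta>) * (y (fst (h t)) - \<theta>)) \<in> borel_measurable (hist (Suc t))"
        by (intro borel_measurable_times borel_measurable_diff borel_measurable_const ytm
            sample_measurable lessI)
      fix h assume h: "h \<in> space (hist (Suc t))"
      have "\<bar>snd (h t) - \<theta>\<bar> \<le> 2" using sample_cases[OF h, of t] \<theta> by auto
      then show "\<bar>(snd (h t) - \<theta>) * (y (fst (h t)) - \<theta>)\<bar> \<le> 2 * (\<mu> / s * R + 1)"
        unfolding abs_mult using yd[OF action_in_domain[OF h lessI]] by (intro mult_mono) auto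
    qed
    have "(\<integral>h. (snd (h t) - \<theta>) * (y (fst (h t)) - \<theta>) \<partial>coin_law \<theta> (Suc t)) = 0"
      by (rule integral_centred_sample[OF \<theta> t(2,1), of "\<lambda>x. y x - \<theta>"])
        (rule borel_measurable_diff[OF ym borel_measurable_const], rule yd)
    then have "s\<^sup>2 / (2 * \<mu>) * ?\<rho> t = (\<integral>h. s\<^sup>2 / (2 * \<mu>) * (y (fst (h t)) - \<theta>)\<^sup>2
        - s\<^sup>2 / \<mu> * ((snd (h t) - \<theta>) * (y (fst (h t)) - \<theta>)) \<partial>coin_law \<theta> (Suc t))"
      using i1 i2 by (simp del: joint_law.simps)
    also have "\<dots> \<le> (\<integral>h. e (h t) \<partial>coin_law \<theta> (Suc t))"
    proof (rule integral_mono)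
      fix h :: "nat \<Rightarrow> real_seq \<times> real"
      have z: "inner_Rn d v (fst (h t) - p) - s * \<theta> / \<mu> = s / \<mu> * (y (fst (h t)) - \<theta>)"
        using pos by (simp add: y_def field_simps)
      have "s\<^sup>2 / (2 * \<mu>) * (y (fst (h t)) - \<theta>)\<^sup>2
            - s\<^sup>2 / \<mu> * ((snd (h t) - \<theta>) * (y (fst (h t)) - \<theta>))
          = \<mu> / 2 * (s / \<mu> * (y (fst (h t)) - \<theta>))\<^sup>2
            - (s * snd (h t) - \<mu> * (s * \<theta> / \<mu>)) * (s / \<mu> * (y (fst (h t)) - \<theta>))"
        using pos by (simp add: field_simps power2_eq_square)
      also have "\<dots> \<le> e (h t)"
        using quadratic_loss_excess[OF pos(1) v, of "fst (h t)" p "s * \<theta> / \<mu>" s "snd (h t)"]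
        unfolding z by (simp add: e_def f_def u_def)
      finally show "s\<^sup>2 / (2 * \<mu>) * (y (fst (h t)) - \<theta>)\<^sup>2
            - s\<^sup>2 / \<mu> * ((snd (h t) - \<theta>) * (y (fst (h t)) - \<theta>)) \<le> e (h t)" .
    next
      show "integrable (coin_law \<theta> (Suc t)) (\<lambda>h. e (h t))" using T by (intro ei) auto
    qed (use i1 i2 in \<open>simp del: joint_law.simps\<close>)
    finally show ?thesis .
  qed
  have \<rho>: "0 \<le> s\<^sup>2 / (2 * \<mu>) * ?\<rho> t" for t
    using pos by (intro mult_nonneg_nonneg Bochner_Integration.integral_nonneg) auto
  have rounds: "{..<T} = insert 0 {1..<T}" using N by auto
  have "s\<^sup>2 / (2 * \<mu>) * (\<Sum>t\<in>{N..<T}. ?\<rho> t) - ?C = - ?C + (\<Sum>t\<in>{N..<T}. s\<^sup>2 / (2 * \<mu>) * ?\<rho> t)"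
    by (simp add: sum_distrib_left del: joint_law.simps)
  \<comment> \<open>Rounds 1 to N - 1 may be added because their risks are nonnegative.\<close>
  also have "\<dots> \<le> - ?C + (\<Sum>t\<in>{1..<T}. s\<^sup>2 / (2 * \<mu>) * ?\<rho> t)"
    using N by (intro add_left_mono sum_mono2 \<rho>) auto
  also have "\<dots> \<le> (\<integral>h. e (h 0) \<partial>coin_law \<theta> (Suc 0)) + (\<Sum>t\<in>{1..<T}. \<integral>h. e (h t) \<partial>coin_law \<theta> (Suc t))"
    by (intro add_mono first sum_mono later) auto
  also have "\<dots> = (\<Sum>t<T. \<integral>h. e (h t) \<partial>coin_law \<theta> (Suc t))"
    by (simp add: rounds del: joint_law.simps)
  also have "\<dots> = (\<Sum>t<T. \<integral>h. e (h t) \<partial>coin_law \<theta> T)"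
    by (intro sum.cong refl integral_joint_law_marginal[OF em eb, symmetric]) auto
  also have "\<dots> = (\<integral>h. regret f T u h \<partial>coin_law \<theta> T)"
    unfolding regret by (intro Bochner_Integration.integral_sum[symmetric] ei) auto
  finally show "s\<^sup>2 / (2 * \<mu>) * (\<Sum>t\<in>{N..<T}. ?\<rho> t) - ?C \<le> (\<integral>h. regret f T u h \<partial>coin_law \<theta> T)" .
qed

end

section \<open>Gradient variance and shift in the coin game\<close>

lemma quadratic_game_sigma_max:
  fixes p v :: real_seq and \<mu> s \<theta> :: real
  assumes X: "X \<subseteq> Rn d" "X \<noteq> {}" and pv: "p \<in> Rn d" "v \<in> Rn d" "norm_Rn d v = 1"
    and \<theta>: "\<bar>\<theta>\<bar> \<le> 1" and T: "2 \<le> T" and P: "prob_space P" and s: "0 \<le> s"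
  defines "f \<equiv> quadratic_loss d \<mu> s p v" and "D \<equiv> coin_adversary \<theta>"
  shows "integrable P (sigma_sq d X f D t)" "integrable P (Sigma_sq d X f D t)"
    and "(sigma_max d X f D T P)\<^sup>2 = s\<^sup>2 * (1 - \<theta>\<^sup>2)" "0 \<le> sigma_max d X f D T P"
    and "Sigma_max d X f D T P = s * (1 - \<theta>)"
proof -
  interpret prob_space P by (rule P)
  have dist: "dist_at D t h = coin (bias \<theta> t)" for t h
    by (simp add: dist_at_def D_def coin_adversary_def)
  have sig: "sigma_sq d X f D t = (\<lambda>h. s\<^sup>2 * (1 - (bias \<theta> t)\<^sup>2))" for t
    using quadratic_variance_sq[OF X pv bias_bound[OF \<theta>]]
    by (simp add: fun_eq_iff sigma_sq_def dist f_def)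
  \<comment> \<open>Nonzero at most in round 1: round 0 is compared with itself, and the bias is
    constant from round 1 on.\<close>
  have Sig: "Sigma_sq d X f D t = (\<lambda>h. s\<^sup>2 * (bias \<theta> t - bias \<theta> (t - 1))\<^sup>2)" for t
    using quadratic_shift_sq[OF X pv bias_bound[OF \<theta>] bias_bound[OF \<theta>]]
    by (simp add: fun_eq_iff Sigma_sq_def dist f_def)
  show "integrable P (sigma_sq d X f D t)" "integrable P (Sigma_sq d X f D t)"
    by (simp_all add: sig Sig)
  have \<theta>2: "\<theta>\<^sup>2 \<le> 1" using \<theta> by (simp add: abs_square_le_1)
  have "(MAX t\<in>{..<T}. \<integral>h. sigma_sq d X f D t h \<partial>P) = s\<^sup>2 * (1 - \<theta>\<^sup>2)"
  proof (rule Max_eqI)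
    show "s\<^sup>2 * (1 - \<theta>\<^sup>2) \<in> (\<lambda>t. \<integral>h. sigma_sq d X f D t h \<partial>P) ` {..<T}"
      \<comment> \<open>The coin of round 0 is deterministic and has variance 0, so round 1 is the
        first to attain the maximum.\<close>
      using T by (intro image_eqI[of _ _ 1]) (auto simp: sig bias_def prob_space)
  qed (use \<theta>2 in \<open>auto simp: sig bias_def prob_space\<close>)
  then show "(sigma_max d X f D T P)\<^sup>2 = s\<^sup>2 * (1 - \<theta>\<^sup>2)" "0 \<le> sigma_max d X f D T P"
    using \<theta>2 by (simp_all add: sigma_max_def)
  have "(MAX t\<in>{..<T}. \<integral>h. Sigma_sq d X f D t h \<partial>P) = s\<^sup>2 * (1 - \<theta>)\<^sup>2"
  proof (rule Max_eqI)
    show "s\<^sup>2 * (1 - \<theta>)\<^sup>2 \<in> (\<lambda>t. \<integral>h. Sigma_sq d X f D t h \<partial>P) ` {..<T}"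
      using T by (intro image_eqI[of _ _ 1]) (auto simp: Sig bias_def prob_space power2_commute)
  qed (auto simp: Sig bias_def prob_space power2_commute)
  then show "Sigma_max d X f D T P = s * (1 - \<theta>)"
    using \<theta> s by (simp add: Sigma_max_def power_mult_distrib[symmetric])
qed

section \<open>Choice of the scale, the prior interval and the horizon\<close>

theorem theorem8:
  shows "\<exists>c>0. \<forall>(d::nat) X \<mu> \<sigma> \<Sigma>'.
    closedin (Euclidean_space d) X \<and> bounded_Rn d X \<and> convex X \<and> 0 < diameter_Rn d X \<and>
    0 < \<mu> \<and> 0 < \<sigma> \<and> 0 < \<Sigma>' \<longrightarrow>
    (\<exists>T0. \<forall>T\<ge>T0. \<forall>A. learning_algorithm d X T A \<longrightarrow>
      (\<exists>(\<Xi> :: real measure) f D u G L.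
        loss_function d X \<Xi> f \<and>
        is_adversary X \<Xi> T D \<and>
        (\<forall>t<T. \<forall>h\<in>space (histories X \<Xi> t). distribution_assumptions d X f G L \<mu> (D t h)) \<and>
        u \<in> X \<and>
        (let P = joint_law X \<Xi> (A \<Xi> f) D T in
          (\<forall>t<T. integrable P (sigma_sq d X f D t) \<and> integrable P (Sigma_sq d X f D t)) \<and>
          integrable P (regret f T u) \<and>
          \<sigma> \<le> sigma_max d X f D T P \<and>
          \<Sigma>' \<le> Sigma_max d X f D T P \<and>
          c / \<mu> * ((sigma_max d X f D T P)\<^sup>2 + (Sigma_max d X f D T P)\<^sup>2) * ln (real T)
            \<le> (\<integral>h. regret f T u h \<partial>P))))"
proof (intro exI[of _ "1 / 256"] conjI allI impI; (elim conjE)?)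
  fix d X and \<mu> \<sigma> \<Sigma>' :: real
  assume closed: "closedin (Euclidean_space d) X" and bounded: "bounded_Rn d X" and "convex X"
    and diam: "0 < diameter_Rn d X" and pos: "0 < \<mu>" "0 < \<sigma>" "0 < \<Sigma>'"
  have X: "X \<subseteq> Rn d" using closed by (rule closedin_subset)
  obtain p v l where p: "p \<in> Rn d" and v: "v \<in> Rn d" "norm_Rn d v = 1" and l: "0 < l"
    and segment: "\<And>c. \<bar>c\<bar> \<le> l \<Longrightarrow> p + c *\<^sub>R v \<in> X"
    using exists_segment[OF X \<open>convex X\<close> diam] by blast
  have ne: "X \<noteq> {}" using segment[of 0] l by auto
  obtain B where B: "\<And>x. x \<in> X \<Longrightarrow> norm_Rn d x \<le> B"
    using bounded by (auto simp: bounded_Rn_def)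
  define R where "R = B + norm_Rn d p"
  have R: "norm_Rn d (x - p) \<le> R" if "x \<in> X" for x
    using norm_Rn_diff_triangle[of d x p] B[OF that] by (simp add: R_def)
  \<comment> \<open>For biases up to 1/2 the shift is at least s / 2 and the variance at least 3/4
    of the square of s, so the factor 2 secures both lower bounds.\<close>
  define s where "s = 2 * max \<sigma> \<Sigma>'"
  have s: "0 < s" "2 * \<sigma> \<le> s" "2 * \<Sigma>' \<le> s" using pos by (auto simp: s_def)
  \<comment> \<open>The second bound keeps the displacement s \<theta> / \<mu> of the comparator
    within the half-length l of the segment.\<close>
  define r where "r = min (1 / 2) (\<mu> * l / s)"
  have r: "0 < r" "r \<le> 1 / 2" "r \<le> \<mu> * l / s"
    unfolding r_def by (use pos s l in simp, rule min.cobounded1, rule min.cobounded2)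
  define N where "N = max 1 (nat \<lceil>7 / r\<^sup>2\<rceil>)"
  have "7 / r\<^sup>2 \<le> real N" by (simp add: N_def) linarith
  then have N: "1 \<le> N" "7 \<le> real N * r\<^sup>2" using r by (auto simp: N_def field_simps)
  define C where "C = \<mu> * R\<^sup>2 + 2 * s * R"
  \<comment> \<open>Chosen so that s^2 / (64 \<mu>) times K is the total of the constant losses: C
    from round 0 and s^2 / (32 \<mu>) ln N from the truncated harmonic sum.\<close>
  define K where "K = 2 * ln (real N) + 64 * \<mu> * C / s\<^sup>2"
  define T0 where "T0 = max (max 2 N) (nat \<lceil>exp K\<rceil>)"
  let ?f = "quadratic_loss d \<mu> s p v"
  show "\<exists>T0. \<forall>T\<ge>T0. \<forall>A. learning_algorithm d X T A \<longrightarrow>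
      (\<exists>(\<Xi> :: real measure) f D u G L.
        loss_function d X \<Xi> f \<and>
        is_adversary X \<Xi> T D \<and>
        (\<forall>t<T. \<forall>h\<in>space (histories X \<Xi> t). distribution_assumptions d X f G L \<mu> (D t h)) \<and>
        u \<in> X \<and>
        (let P = joint_law X \<Xi> (A \<Xi> f) D T in
          (\<forall>t<T. integrable P (sigma_sq d X f D t) \<and> integrable P (Sigma_sq d X f D t)) \<and>
          integrable P (regret f T u) \<and>
          \<sigma> \<le> sigma_max d X f D T P \<and>
          \<Sigma>' \<le> Sigma_max d X f D T P \<and>
          1 / 256 / \<mu> * ((sigma_max d X f D T P)\<^sup>2 + (Sigma_max d X f D T P)\<^sup>2) * ln (real T)
            \<le> (\<integral>h. regret f T u h \<partial>P)))"
  proof (intro exI[of _ T0] allI impI)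
    fix T and A :: "real measure \<Rightarrow> (real_seq \<Rightarrow> real \<Rightarrow> real) \<Rightarrow> real learner"
    assume T0: "T0 \<le> T" and A: "learning_algorithm d X T A"
    have T: "2 \<le> T" "N \<le> T" "nat \<lceil>exp K\<rceil> \<le> T" using T0 by (auto simp: T0_def)
    have "exp K \<le> real T" using T(3) by linarith
    then have K: "K \<le> ln (real T)" using T(1) by (simp add: ln_ge_iff)
    have loss: "loss_function d X signs ?f" by (rule quadratic_loss_function[OF X p v(1)])
    \<comment> \<open>Neither argument involves \<theta>, so the learner is fixed before the bias is
      selected against it.\<close>
    let ?a = "A signs ?f"
    interpret coin_game X ?a T
      using A loss by unfold_locales (simp add: learning_algorithm_def)
    let ?y = "\<lambda>x. \<mu> / s * inner_Rn d v (x - p)"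
    have "?y \<in> borel_measurable (actions X)"
      by (intro borel_measurable_times borel_measurable_const inner_Rn_borel_measurable)
    moreover have "\<bar>?y x\<bar> \<le> \<mu> / s * R" if "x \<in> X" for x
      using pos s by (intro scaled_inner_Rn_bound v R that) simp
    ultimately obtain \<theta> where \<theta>: "\<bar>\<theta>\<bar> \<le> r"
      and hard: "(ln (real T) - ln (real N)) / 16
        \<le> (\<Sum>t\<in>{N..<T}. \<integral>h. (?y (fst (h t)) - \<theta>)\<^sup>2 \<partial>coin_law \<theta> (Suc t))"
      using exists_hard_bias[OF r(1,2) N T(2), of ?y "\<mu> / s * R"] by blast
    have \<theta>1: "\<bar>\<theta>\<bar> \<le> 1" and \<theta>2: "\<bar>\<theta>\<bar> \<le> 1 / 2" using \<theta> r by auto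
    interpret interaction X signs ?a "coin_adversary \<theta>" T
      by (rule interaction_coin[OF \<theta>1])
    define u where "u = p + (s * \<theta> / \<mu>) *\<^sub>R v"
    have "\<bar>s * \<theta> / \<mu>\<bar> = s * \<bar>\<theta>\<bar> / \<mu>" using pos s by (simp add: abs_mult)
    also have "\<dots> \<le> s * (\<mu> * l / s) / \<mu>"
      using \<theta> r pos s by (intro divide_right_mono mult_left_mono) auto
    also have "\<dots> = l" using pos s by simp
    finally have u: "u \<in> X" unfolding u_def by (rule segment)
    let ?P = "coin_law \<theta> T" and ?D = "coin_adversary \<theta>"
    have P: "prob_space ?P" by (rule prob_space_joint_law) simp
    note game = quadratic_game_sigma_max[OF X ne p v \<theta>1 T(1) P less_imp_le[OF s(1)], of \<mu>]
    have reg: "integrable ?P (regret ?f T u)"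
      "s\<^sup>2 / (2 * \<mu>) * (\<Sum>t\<in>{N..<T}. \<integral>h. (?y (fst (h t)) - \<theta>)\<^sup>2 \<partial>coin_law \<theta> (Suc t)) - C
        \<le> (\<integral>h. regret ?f T u h \<partial>?P)"
      unfolding C_def u_def
      by (rule regret_lower_bound[OF R v(2) pos(1) s(1) \<theta>1 N(1) T(2) u[unfolded u_def]], assumption)+
    have sq: "\<theta>\<^sup>2 \<le> 1 / 4"
      using power_mono[OF \<theta>2, of 2] by (simp add: power_divide)
    have s2: "4 * \<sigma>\<^sup>2 \<le> s\<^sup>2"
      using power_mono[OF s(2), of 2] pos by (simp add: power_mult_distrib)
    have "\<sigma>\<^sup>2 \<le> s\<^sup>2 * (3 / 4)" using s2 zero_le_power2[of \<sigma>] by linarith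
    also have "\<dots> \<le> s\<^sup>2 * (1 - \<theta>\<^sup>2)" using sq by (intro mult_left_mono) auto
    finally have sigma: "\<sigma> \<le> sigma_max d X ?f ?D T ?P"
      using game(3,4) by (metis power2_le_imp_le)
    have "\<Sigma>' \<le> s * (1 / 2)" using s by simp
    also have "\<dots> \<le> s * (1 - \<theta>)" using \<theta>2 s by (intro mult_left_mono) auto
    finally have Sigma: "\<Sigma>' \<le> Sigma_max d X ?f ?D T ?P" by (simp only: game(5))
    have "(1 - \<theta>)\<^sup>2 \<le> 9 / 4"
      using power_mono[of "1 - \<theta>" "3 / 2" 2] \<theta>2 by (auto simp: power_divide)
    then have "(1 - \<theta>\<^sup>2) + (1 - \<theta>)\<^sup>2 \<le> 4"
      using zero_le_power2[of \<theta>] by linarith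
    then have "s\<^sup>2 * ((1 - \<theta>\<^sup>2) + (1 - \<theta>)\<^sup>2) \<le> s\<^sup>2 * 4" by (rule mult_left_mono) simp
    then have "(sigma_max d X ?f ?D T ?P)\<^sup>2 + (Sigma_max d X ?f ?D T ?P)\<^sup>2 \<le> 4 * s\<^sup>2"
      unfolding game(3,5) power_mult_distrib by (simp only: distrib_left mult.commute[of 4])
    \<comment> \<open>The constant collects 1/16 from the hard bias, 1/2 from the excess loss, 1/2
      for the half of the logarithm spent on constants, and 1/4 from the bound by 4 s^2.\<close>
    then have "1 / 256 / \<mu> * ((sigma_max d X ?f ?D T ?P)\<^sup>2 + (Sigma_max d X ?f ?D T ?P)\<^sup>2) * ln (real T)
        \<le> 1 / 256 / \<mu> * (4 * s\<^sup>2) * ln (real T)"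
      using pos T by (intro mult_right_mono mult_left_mono) auto
    also have "\<dots> = s\<^sup>2 / (32 * \<mu>) * ln (real T) - s\<^sup>2 / (64 * \<mu>) * ln (real T)"
      using pos by (simp add: field_simps)
    also have "\<dots> \<le> s\<^sup>2 / (32 * \<mu>) * ln (real T) - s\<^sup>2 / (64 * \<mu>) * K"
      using K pos by (intro diff_left_mono mult_left_mono) auto
    also have "\<dots> = s\<^sup>2 / (2 * \<mu>) * ((ln (real T) - ln (real N)) / 16) - C"
      using pos s by (simp add: K_def field_simps)
    also have "\<dots> \<le> (\<integral>h. regret ?f T u h \<partial>?P)"
      using pos by (intro order_trans[OF diff_right_mono[OF mult_left_mono[OF hard]] reg(2)]) simp
    finally have main: "1 / 256 / \<mu> * ((sigma_max d X ?f ?D T ?P)\<^sup>2 + (Sigma_max d X ?f ?D T ?P)\<^sup>2)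
        * ln (real T) \<le> (\<integral>h. regret ?f T u h \<partial>?P)" .
    have dist: "distribution_assumptions d X ?f (\<mu> * R + s) \<mu> \<mu> (?D t h)" for t h
      unfolding coin_adversary_def
      by (rule quadratic_distribution_assumptions[OF X \<open>convex X\<close> p v R pos(1) less_imp_le[OF s(1)]
            bias_bound[OF \<theta>1]])
    show "\<exists>(\<Xi> :: real measure) f D u G L.
        loss_function d X \<Xi> f \<and>
        is_adversary X \<Xi> T D \<and>
        (\<forall>t<T. \<forall>h\<in>space (histories X \<Xi> t). distribution_assumptions d X f G L \<mu> (D t h)) \<and>
        u \<in> X \<and>
        (let P = joint_law X \<Xi> (A \<Xi> f) D T in
          (\<forall>t<T. integrable P (sigma_sq d X f D t) \<and> integrable P (Sigma_sq d X f D t)) \<and>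
          integrable P (regret f T u) \<and>
          \<sigma> \<le> sigma_max d X f D T P \<and>
          \<Sigma>' \<le> Sigma_max d X f D T P \<and>
          1 / 256 / \<mu> * ((sigma_max d X f D T P)\<^sup>2 + (Sigma_max d X f D T P)\<^sup>2) * ln (real T)
            \<le> (\<integral>h. regret f T u h \<partial>P))"
      unfolding Let_def
      by (intro exI[of _ signs] exI[of _ ?f] exI[of _ ?D] exI[of _ u] exI[of _ "\<mu> * R + s"]
          exI[of _ \<mu>] conjI allI impI ballI loss adversary dist u game(1,2) reg(1) sigma Sigma main)
  qed
qed simp

end
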